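(* We have $a_2(n) \geq b_2(n)$ for all integers $n \geq 0$, and $a_3(n) \geq b_3(n)$ for all integers $n > 7$.
   Context: A partition $\lambda=(\lambda_1,\dots,\lambda_\ell)$ of $n\in\mathbb N_0$ is a non-increasing sequence of positive integers (parts) with sum $n$; the empty partition is the only partition of $0$. The Young diagram of $\lambda$ is the left-justified array of boxes with $\lambda_i$ boxes in row $i$. The conjugate $\lambda'$ is the partition whose Young diagram has the columns of $\lambda$ as rows. The hook length of the box in row $i$ and column $j$ of the diagram of $\lambda$ is $h(i,j)=\lambda_i+\lambda'_j-i-j+1$; the number of hooks of length $t$ in $\lambda$ is the number of boxes with hook length exactly $t$. An odd partition is a partition all of whose parts are odd; a distinct partition is a partition whose parts are pairwise distinct. For $t\ge 1$, $a_t(n)$ (respectively $b_t(n)$) denotes the total number of hooks of length $t$ in all odd (respectively distinct) partitions of $n$. *)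

theory Defs
  imports Main
begin

definition partitions :: "nat \<Rightarrow> nat list set" where
  "partitions n = {xs. sorted_wrt (\<ge>) xs \<and> (\<forall>p\<in>set xs. 0 < p) \<and> sum_list xs = n}"

text \<open>Rows and columns are numbered from 1; parts beyond the last one are read as 0.\<close>

definition part :: "nat list \<Rightarrow> nat \<Rightarrow> nat" where
  "part xs i = (if 1 \<le> i \<and> i \<le> length xs then xs ! (i - 1) else 0)"

definition young_diagram :: "nat list \<Rightarrow> (nat \<times> nat) set" where
  "young_diagram xs = {(i, j). 1 \<le> i \<and> i \<le> length xs \<and> 1 \<le> j \<and> j \<le> part xs i}"

definition conjugate :: "nat list \<Rightarrow> nat list" where
  "conjugate xs = map (\<lambda>j. card {i. (i, j) \<in> young_diagram xs}) [1..<Suc (part xs 1)]"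

text \<open>
  For a box of the diagram, \<open>i \<le> part (conjugate xs) j\<close> and \<open>j \<le> part xs i\<close>; with the
  summand 1 placed first, the subtractions on \<^typ>\<open>nat\<close> do not truncate there.
\<close>

definition hook_length :: "nat list \<Rightarrow> nat \<Rightarrow> nat \<Rightarrow> nat" where
  "hook_length xs i j = part xs i + part (conjugate xs) j + 1 - i - j"

definition num_hooks :: "nat \<Rightarrow> nat list \<Rightarrow> nat" where
  "num_hooks t xs = card {(i, j). (i, j) \<in> young_diagram xs \<and> hook_length xs i j = t}"

definition odd_partitions :: "nat \<Rightarrow> nat list set" where
  "odd_partitions n = {xs \<in> partitions n. \<forall>p\<in>set xs. odd p}"

definition distinct_partitions :: "nat \<Rightarrow> nat list set" where
  "distinct_partitions n = {xs \<in> partitions n. distinct xs}"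

definition hooks_odd :: "nat \<Rightarrow> nat \<Rightarrow> nat" where
  "hooks_odd t n = (\<Sum>xs\<in>odd_partitions n. num_hooks t xs)"

definition hooks_distinct :: "nat \<Rightarrow> nat \<Rightarrow> nat" where
  "hooks_distinct t n = (\<Sum>xs\<in>distinct_partitions n. num_hooks t xs)"

text \<open>
  The sums and cardinalities above range over finite sets, and \<^const>\<open>conjugate\<close> is the
  transposition of diagrams.
\<close>

lemma length_le_sum_list: "\<forall>p\<in>set xs. 0 < p \<Longrightarrow> length xs \<le> sum_list (xs :: nat list)"
proof (induction xs)
  case (Cons p xs)
  then have "length xs \<le> sum_list xs" "0 < p" by simp_all
  then show ?case by simp
qed simp

lemma finite_partitions: "finite (partitions n)"
proof (rule finite_subset)
  show "partitions n \<subseteq> {xs. set xs \<subseteq> {..n} \<and> length xs \<le> n}"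
  proof
    fix xs assume "xs \<in> partitions n"
    then have pos: "\<forall>p\<in>set xs. 0 < p" and n: "sum_list xs = n"
      unfolding partitions_def by blast+
    have "set xs \<subseteq> {..n}" using member_le_sum_list[of _ xs] n by auto
    moreover have "length xs \<le> n" using length_le_sum_list[OF pos] n by simp
    ultimately show "xs \<in> {xs. set xs \<subseteq> {..n} \<and> length xs \<le> n}" by blast
  qed
  show "finite {xs. set xs \<subseteq> {..n} \<and> length xs \<le> n}"
    by (rule finite_lists_length_le) simp
qed

lemma finite_odd_partitions: "finite (odd_partitions n)"
  and finite_distinct_partitions: "finite (distinct_partitions n)"
  by (simp_all add: odd_partitions_def distinct_partitions_def finite_partitions)

lemma finite_young_diagram: "finite (young_diagram xs)"
proof -
  have "young_diagram xs = (SIGMA i:{1..length xs}. {1..part xs i})"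
    by (auto simp: young_diagram_def)
  then show ?thesis by simp
qed

lemma part_antimono:
  assumes "xs \<in> partitions n" "1 \<le> i" "i \<le> k"
  shows "part xs k \<le> part xs i"
proof (cases "i = k \<or> k > length xs")
  case False
  then have "xs ! (k - 1) \<le> xs ! (i - 1)"
    using assms sorted_wrt_nth_less[of "(\<ge>)" xs "i - 1" "k - 1"]
    by (auto simp: partitions_def)
  then show ?thesis using assms False by (auto simp: part_def)
qed (auto simp: part_def)

lemma part_conjugate:
  "part (conjugate xs) j =
     (if 1 \<le> j \<and> j \<le> part xs 1 then card {i. (i, j) \<in> young_diagram xs} else 0)"
  unfolding part_def[of "conjugate xs"] unfolding conjugate_def
  by (auto simp del: upt_Suc)

lemma young_diagram_iff_conjugate:
  assumes xs: "xs \<in> partitions n" and "1 \<le> i" "1 \<le> j"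
  shows "j \<le> part xs i \<longleftrightarrow> i \<le> part (conjugate xs) j"
proof -
  let ?C = "{i. (i, j) \<in> young_diagram xs}"
  have fin: "finite ?C"
    by (rule finite_subset[of _ "{..length xs}"]) (auto simp: young_diagram_def)
  have C: "k \<in> ?C \<longleftrightarrow> 1 \<le> k \<and> j \<le> part xs k" for k
    using \<open>1 \<le> j\<close> by (auto simp: young_diagram_def part_def split: if_splits)
  show ?thesis
  proof
    assume j: "j \<le> part xs i"
    have "{1..i} \<subseteq> ?C"
    proof
      fix k assume "k \<in> {1..i}"
      then have k: "1 \<le> k" "k \<le> i" by simp_all
      then have "j \<le> part xs k" using part_antimono[OF xs k] j by linarith
      with k(1) show "k \<in> ?C" by (simp only: C)
    qed
    then have "i \<le> card ?C" using card_mono[OF fin, of "{1..i}"] by simp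
    moreover have "j \<le> part xs 1"
      using part_antimono[OF xs, of 1 i] \<open>1 \<le> i\<close> j by simp
    ultimately show "i \<le> part (conjugate xs) j" using \<open>1 \<le> j\<close> by (simp add: part_conjugate)
  next
    assume i: "i \<le> part (conjugate xs) j"
    show "j \<le> part xs i"
    proof (rule ccontr)
      assume n: "\<not> j \<le> part xs i"
      have "?C \<subseteq> {1..<i}"
      proof
        fix k assume "k \<in> ?C"
        then have k: "1 \<le> k" "j \<le> part xs k" by (simp_all only: C)
        then have "k < i"
          using n part_antimono[OF xs \<open>1 \<le> i\<close>, of k] by linarith
        then show "k \<in> {1..<i}" using k by simp
      qed
      then have "card ?C \<le> i - 1" using card_mono[of "{1..<i}" ?C] by simp
      then show False using i \<open>1 \<le> i\<close> by (simp add: part_conjugate split: if_splits)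
    qed
  qed
qed

lemma young_diagram_conjugate:
  assumes "xs \<in> partitions n"
  shows "young_diagram (conjugate xs) = (young_diagram xs)\<inverse>"
proof -
  have mem: "(i, j) \<in> young_diagram ys \<longleftrightarrow> 1 \<le> i \<and> 1 \<le> j \<and> j \<le> part ys i" for i j ys
    by (auto simp: young_diagram_def part_def split: if_splits)
  have "(j, i) \<in> young_diagram (conjugate xs) \<longleftrightarrow> (j, i) \<in> (young_diagram xs)\<inverse>" for i j
    unfolding converse_iff mem using young_diagram_iff_conjugate[OF assms, of i j] by linarith
  then show ?thesis by (auto simp only: set_eq_iff split_paired_All)
qed

end

theory Submission
  imports Defs "HOL-Computational_Algebra.Formal_Power_Series" "HOL-Library.Multiset"
begin

text \<open>
Put \<open>D = (1 + q) (1 + q\<^sup>2) (1 + q\<^sup>3) \<dots>\<close>, the generating function of the partitions into distinct parts and,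
by Euler's theorem, of the partitions into odd parts. A hook with arm \<open>a\<close> and leg \<open>l\<close> is visible
in the multiplicities of the parts near the end of its row (\<open>card_hooks\<close>), so the numbers of
hooks of length 2 and 3 have explicit generating functions. For odd partitions these are \<open>D\<close> times a
rational function. For distinct partitions they are sums over \<open>p\<close> of \<open>D\<close> divided by factors
\<open>1 + q\<^sup>p\<close>, and the sums that stem from gaps between parts telescope, because
\<open>1/(1 + q\<^sup>p) - 1/(1 + q\<^bsup>p-1\<^esup>)\<close> is a multiple of \<open>q\<^bsup>p-1\<^esup>/((1 + q\<^sup>p) (1 + q\<^bsup>p-1\<^esup>))\<close> by a factor
that does not depend on \<open>p\<close> (\<open>gaps2_telescope\<close>, \<open>gaps3_telescope\<close>).

For length 2 the difference of the two generating functions turns out to be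
\<open>D (q\<^sup>3 - q\<^sup>4 + q\<^sup>5) / (1 - q\<^sup>4)\<close>, and the coefficients of \<open>D\<close> increase weakly.

For length 3 one summand does not telescope: the total number of parts \<open>p \<ge> 2\<close> of the distinct
partitions, which is the sum of \<open>D q\<^sup>p/(1 + q\<^sup>p)\<close>. For \<open>p \<ge> 4\<close> the fraction \<open>x/(1 + x)\<close>
with \<open>x = q\<^sup>p\<close> is replaced by \<open>x - x\<^sup>2 + x\<^sup>3 - x\<^sup>4/2\<close>. The error is
\<open>x\<^sup>4 (1 - x) / (2 (1 + x))\<close>; multiplied by \<open>D\<close> it has nonnegative coefficients, since adding \<open>p\<close> to the
largest part is an injection between partitions without the part \<open>p\<close> (\<open>avoiding_truncation\<close>).
The summands for \<open>p = 2, 3\<close> are kept exactly: for larger values the bound is sharp enough,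
for these two it would already spoil the inequality for small \<open>n\<close>.

After this replacement, twice the difference is bounded below by a series \<open>Y\<close> with
\<open>(1 - q\<^bsup>12\<^esup>) Y = E P\<close>, where \<open>E = D/(1 + q)\<close> counts the distinct partitions without the part 1 and
\<open>P\<close> is a polynomial with few terms. Its coefficients from the index 8 on are nonnegative
(\<open>reduced_difference_nonneg\<close>) because \<open>E(m - 1) \<le> E(m)\<close> for \<open>m \<ge> 2\<close> (\<open>no_ones_step\<close>) and
\<open>E(m) \<le> E(m - 1) + E(m - 5)\<close> for \<open>m \<ge> 10\<close> (\<open>no_ones_le_add\<close>); finitely many small
indices are settled by the first values of \<open>E\<close>.
\<close>

unbundle fps_syntax

section \<open>Power series and locally finite sums\<close>

lemma fps_X_power_mult_small: "n < k \<Longrightarrow> (fps_X ^ k * f) $ n = (0 :: int)"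
  by (simp add: fps_X_power_mult_nth)

lemma fps_double_nth: "(2 * f) $ n = 2 * f $ n" for f :: "int fps"
  by (simp add: fps_numeral_fps_const)

text \<open>
The infinite sum of a family of power series whose \<open>j\<close>-th member is divisible by \<open>X\<^sup>j\<close>. Only the
members up to the index \<open>n\<close> reach the coefficient at \<open>n\<close>, so no notion of convergence is needed.
\<close>
definition fps_sum :: "(nat \<Rightarrow> int fps) \<Rightarrow> int fps" where
  "fps_sum f = Abs_fps (\<lambda>n. \<Sum>j\<le>n. f j $ n)"

lemma fps_sum_nth: "fps_sum f $ n = (\<Sum>j\<le>n. f j $ n)"
  by (simp add: fps_sum_def)

lemma fps_sum_diff: "fps_sum (\<lambda>j. f j - g j) = fps_sum f - fps_sum g"
  by (rule fps_ext) (simp add: fps_sum_nth sum_subtractf)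

lemma fps_sum_mult:
  assumes "\<And>j n. n < j \<Longrightarrow> f j $ n = 0"
  shows "c * fps_sum f = fps_sum (\<lambda>j. c * f j)"
proof (rule fps_ext)
  fix n
  have "(c * fps_sum f) $ n = (\<Sum>i=0..n. c $ i * (\<Sum>j\<le>n - i. f j $ (n - i)))"
    by (simp add: fps_mult_nth fps_sum_nth)
  also have "\<dots> = (\<Sum>i=0..n. c $ i * (\<Sum>j\<le>n. f j $ (n - i)))"
    by (intro sum.cong refl arg_cong2[where f = "(*)"] sum.mono_neutral_left) (auto simp: assms)
  also have "\<dots> = (\<Sum>i=0..n. \<Sum>j\<le>n. c $ i * f j $ (n - i))"
    by (simp add: sum_distrib_left)
  also have "\<dots> = (\<Sum>j\<le>n. \<Sum>i=0..n. c $ i * f j $ (n - i))"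
    by (rule sum.swap)
  finally show "(c * fps_sum f) $ n = fps_sum (\<lambda>j. c * f j) $ n"
    by (simp add: fps_sum_nth fps_mult_nth)
qed

text \<open>
The partial sum up to the index \<open>n\<close> is \<open>h (n + 1) - h 0\<close>. By the definition of the infinite sum it is
enough that this one agrees with the limit at the coefficient \<open>n\<close>.
\<close>
lemma fps_sum_telescope:
  assumes "\<And>n. h (Suc n) $ n = l $ n"
  shows "fps_sum (\<lambda>j. h (Suc j) - h j) = l - h 0"
proof (rule fps_ext)
  fix n
  have "(\<Sum>j\<le>n. h (Suc j) $ n - h j $ n) = h (Suc n) $ n - h 0 $ n"
    using sum_telescope[of "\<lambda>j. - (h j $ n)" n] by simp
  then show "fps_sum (\<lambda>j. h (Suc j) - h j) $ n = (l - h 0) $ n"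
    by (simp add: fps_sum_nth assms)
qed

lemma fps_sum_even:
  assumes "\<And>j. odd j \<Longrightarrow> f j = 0" and "\<And>j n. n < j \<Longrightarrow> f j $ n = 0"
  shows "fps_sum f = fps_sum (\<lambda>i. f (2 * i))"
proof (rule fps_ext)
  fix n
  have "(\<Sum>i\<le>n. f (2 * i) $ n) = (\<Sum>j\<in>(*) 2 ` {..n}. f j $ n)"
    by (subst sum.reindex) (auto simp: inj_on_def)
  also have "\<dots> = (\<Sum>j\<in>{..2*n}. f j $ n)"
  proof (rule sum.mono_neutral_left)
    show "\<forall>j\<in>{..2*n} - (*) 2 ` {..n}. f j $ n = 0"
    proof
      fix j assume j: "j \<in> {..2*n} - (*) 2 ` {..n}"
      have "odd j"
      proof
        assume "even j"
        then obtain i where "j = 2 * i" by (elim evenE)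
        with j show False by auto
      qed
      then show "f j $ n = 0" by (simp add: assms(1))
    qed
  qed auto
  also have "\<dots> = (\<Sum>j\<le>n. f j $ n)"
    by (rule sum.mono_neutral_right) (auto simp: assms)
  finally show "fps_sum f $ n = fps_sum (\<lambda>i. f (2 * i)) $ n" by (simp add: fps_sum_nth)
qed

lemma fps_sum_odd:
  assumes "\<And>j. even j \<Longrightarrow> f j = 0" and "\<And>j n. n < j \<Longrightarrow> f j $ n = 0"
  shows "fps_sum f = fps_sum (\<lambda>i. f (2 * i + 1))"
proof (rule fps_ext)
  fix n
  have "(\<Sum>i\<le>n. f (2 * i + 1) $ n) = (\<Sum>j\<in>(\<lambda>i. 2 * i + 1) ` {..n}. f j $ n)"
    by (subst sum.reindex) (auto simp: inj_on_def)
  also have "\<dots> = (\<Sum>j\<in>{..2*n+1}. f j $ n)"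
  proof (rule sum.mono_neutral_left)
    show "\<forall>j\<in>{..2*n+1} - (\<lambda>i. 2 * i + 1) ` {..n}. f j $ n = 0"
    proof
      fix j assume j: "j \<in> {..2*n+1} - (\<lambda>i. 2 * i + 1) ` {..n}"
      have "even j"
      proof (rule ccontr)
        assume "odd j"
        then obtain i where "j = 2 * i + 1" by (elim oddE)
        with j show False by auto
      qed
      then show "f j $ n = 0" by (simp add: assms(1))
    qed
  qed auto
  also have "\<dots> = (\<Sum>j\<le>n. f j $ n)"
    by (rule sum.mono_neutral_right) (auto simp: assms)
  finally show "fps_sum f $ n = fps_sum (\<lambda>i. f (2 * i + 1)) $ n" by (simp add: fps_sum_nth)
qed

text \<open>
The series \<open>d X\<^sup>a / (1 - X\<^sup>k)\<close> for \<open>k > 0\<close>; it arises as a sum over the parts \<open>p\<close> in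
an arithmetic progression.
\<close>
definition progression :: "nat \<Rightarrow> nat \<Rightarrow> int fps \<Rightarrow> int fps" where
  "progression a k d = fps_sum (\<lambda>i. fps_X ^ (a + k * i) * d)"

lemma progression_mult:
  assumes "0 < k"
  shows "(1 - fps_X ^ k) * progression a k d = fps_X ^ a * d"
proof -
  have small: "(fps_X ^ (a + k * i) * d) $ n = 0" if "n < i" for i n
  proof -
    have "i \<le> a + k * i" using assms by (simp add: trans_le_add2)
    with that have "n < a + k * i" by linarith
    then show ?thesis by (simp add: fps_X_power_mult_nth)
  qed
  have "(1 - fps_X ^ k) * progression a k d = fps_sum (\<lambda>i. (1 - fps_X ^ k) * (fps_X ^ (a + k * i) * d))"
    unfolding progression_def using small by (rule fps_sum_mult)
  also have "\<dots> = fps_sum (\<lambda>i. (- (fps_X ^ (a + k * Suc i) * d)) - (- (fps_X ^ (a + k * i) * d)))"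
    by (simp add: algebra_simps power_add)
  also have "\<dots> = 0 - (- (fps_X ^ (a + k * 0) * d))"
  proof (rule fps_sum_telescope)
    show "(- (fps_X ^ (a + k * Suc n) * d)) $ n = 0 $ n" for n
      using small[of n "Suc n"] by simp
  qed
  finally show ?thesis by simp
qed

lemma fps_sum_shift:
  assumes "\<And>j n. n < j \<Longrightarrow> f j $ n = 0"
  shows "fps_sum f = f 0 + fps_sum (\<lambda>j. f (Suc j))"
proof (rule fps_ext)
  fix n
  have "(\<Sum>j\<le>n. f j $ n) = (\<Sum>j\<le>Suc n. f j $ n)" using assms by simp
  also have "\<dots> = f 0 $ n + (\<Sum>j\<le>n. f (Suc j) $ n)" by (rule sum.atMost_Suc_shift)
  finally show "fps_sum f $ n = (f 0 + fps_sum (\<lambda>j. f (Suc j))) $ n" by (simp add: fps_sum_nth)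
qed

lemma fps_sum_progression_even:
  assumes "\<And>i. a + k * i = g (2 * i)" "\<And>j. j \<le> g j"
  shows "fps_sum (\<lambda>j. if even j then fps_X ^ g j * d else 0) = progression a k d"
  unfolding progression_def
  by (subst fps_sum_even) (auto simp: assms(1) intro!: fps_X_power_mult_small intro: less_le_trans[OF _ assms(2)])

lemma fps_sum_progression_odd:
  assumes "\<And>i. a + k * i = g (2 * i + 1)" "\<And>j. j \<le> g j"
  shows "fps_sum (\<lambda>j. if odd j then fps_X ^ g j * d else 0) = progression a k d"
  unfolding progression_def
  by (subst fps_sum_odd) (auto simp: assms(1) intro!: fps_X_power_mult_small intro: less_le_trans[OF _ assms(2)])

section \<open>Partitions into distinct parts\<close>

text \<open>
The partitions of \<open>n\<close> into distinct parts from \<open>S\<close>, each represented by its set of parts.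
\<close>
definition part_sets :: "nat set \<Rightarrow> nat \<Rightarrow> nat set set" where
  "part_sets S n = {B. finite B \<and> B \<subseteq> S \<and> \<Sum>B = n}"

definition distinct_gf :: "nat set \<Rightarrow> int fps" where
  "distinct_gf S = Abs_fps (\<lambda>n. int (card (part_sets S n)))"

lemma distinct_gf_nth: "distinct_gf S $ n = int (card (part_sets S n))"
  by (simp add: distinct_gf_def)

lemma mem_part_sets_le:
  assumes "B \<in> part_sets S n" "x \<in> B"
  shows "x \<le> n"
  using assms member_le_sum[of x B "\<lambda>x. x"] by (simp add: part_sets_def)

lemma finite_part_sets: "finite (part_sets S n)"
  by (rule finite_subset[of _ "Pow {..n}"]) (auto dest: mem_part_sets_le)

text \<open>
Deleting the part \<open>p\<close> lowers the sum by \<open>p\<close>.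
\<close>
lemma card_part_sets_containing:
  assumes "p \<in> S"
  shows "int (card {B \<in> part_sets S n. p \<in> B}) = (fps_X ^ p * distinct_gf (S - {p})) $ n"
proof (cases "n < p")
  case True
  then have "{B \<in> part_sets S n. p \<in> B} = {}"
    by (auto dest: mem_part_sets_le)
  with True show ?thesis by (simp only: fps_X_power_mult_nth card.empty) simp
next
  case False
  have "bij_betw (insert p) (part_sets (S - {p}) (n - p)) {B \<in> part_sets S n. p \<in> B}"
  proof (rule bij_betw_byWitness[where f' = "\<lambda>B. B - {p}"])
    show "insert p ` part_sets (S - {p}) (n - p) \<subseteq> {B \<in> part_sets S n. p \<in> B}"
      using assms False by (auto simp: part_sets_def subset_Diff_insert)
    show "(\<lambda>B. B - {p}) ` {B \<in> part_sets S n. p \<in> B} \<subseteq> part_sets (S - {p}) (n - p)"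
      by (auto simp: part_sets_def sum_diff1_nat)
  qed (auto simp: part_sets_def)
  then show ?thesis
    using False by (simp add: fps_X_power_mult_nth distinct_gf_nth bij_betw_same_card)
qed

lemma distinct_gf_remove:
  assumes "p \<in> S"
  shows "distinct_gf S = (1 + fps_X ^ p) * distinct_gf (S - {p})"
proof (rule fps_ext)
  fix n
  have "part_sets S n = {B \<in> part_sets S n. p \<in> B} \<union> part_sets (S - {p}) n"
    by (auto simp: part_sets_def)
  then have "card (part_sets S n)
      = card ({B \<in> part_sets S n. p \<in> B} \<union> part_sets (S - {p}) n)"
    by (rule arg_cong)
  also have "\<dots> = card {B \<in> part_sets S n. p \<in> B} + card (part_sets (S - {p}) n)"
    by (rule card_Un_disjoint) (auto simp: finite_part_sets, auto simp: part_sets_def)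
  finally have "card (part_sets S n)
      = card {B \<in> part_sets S n. p \<in> B} + card (part_sets (S - {p}) n)" .
  then show "distinct_gf S $ n = ((1 + fps_X ^ p) * distinct_gf (S - {p})) $ n"
    using card_part_sets_containing[OF assms, of n]
    by (simp add: distinct_gf_nth distrib_right)
qed

lemma distinct_gf_cong:
  assumes "S \<inter> {1..n} = T \<inter> {1..n}" "0 \<notin> S" "0 \<notin> T"
  shows "distinct_gf S $ n = distinct_gf T $ n"
proof -
  have "part_sets U n = part_sets (U \<inter> {1..n}) n" if "0 \<notin> U" for U
  proof (intro equalityI subsetI)
    fix B assume B: "B \<in> part_sets U n"
    have "B \<subseteq> U \<inter> {1..n}"
    proof
      fix x assume "x \<in> B"
      then have "x \<le> n" "x \<in> U" using B mem_part_sets_le[OF B] by (auto simp: part_sets_def)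
      with that show "x \<in> U \<inter> {1..n}" by (cases x) auto
    qed
    with B show "B \<in> part_sets (U \<inter> {1..n}) n" by (simp add: part_sets_def)
  qed (auto simp: part_sets_def)
  then show ?thesis using assms by (metis distinct_gf_nth)
qed

lemma distinct_gf_empty: "distinct_gf {} = 1"
proof (rule fps_ext)
  fix n
  have "part_sets {} n = {B. B = {} \<and> n = 0}" by (auto simp: part_sets_def)
  then show "distinct_gf {} $ n = 1 $ n" by (cases "n = 0") (simp_all add: distinct_gf_nth)
qed

lemma distinct_gf_eq_prod:
  "finite S \<Longrightarrow> distinct_gf S = (\<Prod>k\<in>S. 1 + fps_X ^ k)"
proof (induction S rule: finite_induct)
  case (insert p S)
  then show ?case using distinct_gf_remove[of p "insert p S"] by simp
qed (simp add: distinct_gf_empty)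

text \<open>
Adding \<open>k\<close> to the largest part is injective: the result still has this part as its largest one,
so the map can be undone. It needs a largest part to exist, whence \<open>m > 0\<close>.
\<close>
lemma distinct_gf_shift_le:
  assumes S: "\<And>s. s \<in> S \<Longrightarrow> s + k \<in> S" and "0 < m"
  shows "distinct_gf S $ m \<le> distinct_gf S $ (m + k)"
proof -
  define f where "f B = insert (Max B + k) (B - {Max B})" for B :: "nat set"
  define g where "g B = insert (Max B - k) (B - {Max B})" for B :: "nat set"
  have f: "Max (f B) = Max B + k \<and> Max B + k \<notin> B - {Max B} \<and> finite B \<and> Max B \<in> B"
    if B: "B \<in> part_sets S m" for B
  proof -
    have fin: "finite B" "B \<noteq> {}" using B \<open>0 < m\<close> by (auto simp: part_sets_def)
    then have less: "x < Max B" if "x \<in> B - {Max B}" for x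
      using that by (simp add: less_le)
    then have "Max (f B) = Max B + k"
      unfolding f_def using fin by (intro Max_eqI) (auto dest: less_imp_le intro: trans_le_add1)
    moreover have "Max B + k \<notin> B - {Max B}" using less[of "Max B + k"] by linarith
    ultimately show ?thesis using fin by simp
  qed
  have "inj_on f (part_sets S m)"
  proof (rule inj_on_inverseI[of _ g])
    fix B assume "B \<in> part_sets S m"
    note B = f[OF this]
    then have "f B - {Max B + k} = B - {Max B}" by (simp add: f_def)
    then show "g (f B) = B" using B by (simp add: g_def insert_absorb)
  qed
  moreover have "f ` part_sets S m \<subseteq> part_sets S (m + k)"
  proof (rule image_subsetI)
    fix B assume mem: "B \<in> part_sets S m"
    note B = f[OF this]
    have "\<Sum>(f B) = Max B + k + \<Sum>(B - {Max B})" using B by (simp add: f_def)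
    also have "\<dots> = \<Sum>B + k" using B sum.remove[of B "Max B" "\<lambda>x. x"] by simp
    finally show "f B \<in> part_sets S (m + k)"
      using mem B S[of "Max B"] by (auto simp: part_sets_def f_def)
  qed
  ultimately have "card (part_sets S m) \<le> card (part_sets S (m + k))"
    by (intro card_inj_on_le[of f]) (auto simp: finite_part_sets)
  then show ?thesis by (simp add: distinct_gf_nth)
qed

section \<open>Partitions with repeated parts and Euler's theorem\<close>

text \<open>
The partitions of \<open>n\<close> into parts from \<open>S\<close>, each represented by its multiset of parts.
\<close>
definition part_multisets :: "nat set \<Rightarrow> nat \<Rightarrow> nat multiset set" where
  "part_multisets S n = {M. set_mset M \<subseteq> S \<and> sum_mset M = n}"

definition partition_gf :: "nat set \<Rightarrow> int fps" where
  "partition_gf S = Abs_fps (\<lambda>n. int (card (part_multisets S n)))"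

lemma partition_gf_nth: "partition_gf S $ n = int (card (part_multisets S n))"
  by (simp add: partition_gf_def)

lemma mset_image_partitions:
  assumes "0 \<notin> S"
  shows "mset ` {xs \<in> partitions n. set xs \<subseteq> S} = part_multisets S n"
proof (intro equalityI subsetI)
  fix M assume "M \<in> part_multisets S n"
  then have "rev (sorted_list_of_multiset M) \<in> {xs \<in> partitions n. set xs \<subseteq> S}"
    using assms by (auto simp: part_multisets_def partitions_def sorted_wrt_rev
        simp flip: sum_mset_sum_list intro!: gr0I)
  then show "M \<in> mset ` {xs \<in> partitions n. set xs \<subseteq> S}"
    by (rule rev_image_eqI) simp
qed (auto simp: part_multisets_def partitions_def sum_mset_sum_list)

lemma inj_on_mset_partitions: "inj_on mset (partitions n)"
proof (rule inj_on_inverseI[of _ "\<lambda>M. rev (sorted_list_of_multiset M)"])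
  fix xs assume "xs \<in> partitions n"
  then have "sorted (rev xs)" by (simp add: partitions_def sorted_wrt_rev)
  then have "sort xs = rev xs" by (intro properties_for_sort) simp_all
  then show "rev (sorted_list_of_multiset (mset xs)) = xs" by simp
qed

lemma finite_part_multisets: "0 \<notin> S \<Longrightarrow> finite (part_multisets S n)"
  by (simp flip: mset_image_partitions add: finite_partitions)

text \<open>
Deleting \<open>m\<close> copies of \<open>p\<close> lowers the sum by \<open>m p\<close>.
\<close>
lemma card_part_multisets_count:
  assumes "p \<in> S"
  shows "int (card {M \<in> part_multisets S n. m \<le> count M p}) = (fps_X ^ (m * p) * partition_gf S) $ n"
proof (cases "n < m * p")
  case True
  have "m * p \<le> sum_mset M" if "m \<le> count M p" for M
  proof -
    have "M = replicate_mset m p + (M - replicate_mset m p)"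
      using that by (simp add: count_le_replicate_mset_subset_eq)
    then have "sum_mset M = sum_mset (replicate_mset m p) + sum_mset (M - replicate_mset m p)"
      by (metis sum_mset.union)
    then show ?thesis by simp
  qed
  then have "{M \<in> part_multisets S n. m \<le> count M p} = {}"
    using True by (fastforce simp: part_multisets_def)
  with True show ?thesis by (simp only: fps_X_power_mult_nth card.empty) simp
next
  case False
  have "bij_betw ((+) (replicate_mset m p)) (part_multisets S (n - m * p))
      {M \<in> part_multisets S n. m \<le> count M p}"
  proof (rule bij_betw_byWitness[where f' = "\<lambda>M. M - replicate_mset m p"])
    show "(+) (replicate_mset m p) ` part_multisets S (n - m * p)
        \<subseteq> {M \<in> part_multisets S n. m \<le> count M p}"
      using assms False by (auto simp: part_multisets_def split: if_splits)
    show "(\<lambda>M. M - replicate_mset m p) ` {M \<in> part_multisets S n. m \<le> count M p}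
        \<subseteq> part_multisets S (n - m * p)"
      by (auto simp: part_multisets_def count_le_replicate_mset_subset_eq sum_mset_diff dest: in_diffD)
  qed (auto simp: part_multisets_def count_le_replicate_mset_subset_eq)
  then have "card (part_multisets S (n - m * p))
      = card {M \<in> part_multisets S n. m \<le> count M p}"
    by (rule bij_betw_same_card)
  then show ?thesis
    using False by (simp add: fps_X_power_mult_nth partition_gf_nth)
qed

lemma partition_gf_remove:
  assumes "p \<in> S" "0 \<notin> S"
  shows "(1 - fps_X ^ p) * partition_gf S = partition_gf (S - {p})"
proof (rule fps_ext)
  fix n
  have "part_multisets S n = {M \<in> part_multisets S n. 1 \<le> count M p} \<union> part_multisets (S - {p}) n"
    by (auto simp: part_multisets_def not_le count_eq_zero_iff)
  then have "card (part_multisets S n)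
      = card ({M \<in> part_multisets S n. 1 \<le> count M p} \<union> part_multisets (S - {p}) n)"
    by (rule arg_cong)
  also have "\<dots> = card {M \<in> part_multisets S n. 1 \<le> count M p} + card (part_multisets (S - {p}) n)"
    using finite_part_multisets[of S n] finite_part_multisets[of "S - {p}" n] assms(2)
    by (intro card_Un_disjoint) (auto, auto simp: part_multisets_def)
  finally have "card (part_multisets S n)
      = card {M \<in> part_multisets S n. 1 \<le> count M p} + card (part_multisets (S - {p}) n)" .
  then show "((1 - fps_X ^ p) * partition_gf S) $ n = partition_gf (S - {p}) $ n"
    using card_part_multisets_count[OF assms(1), of n 1]
    by (simp add: partition_gf_nth left_diff_distrib)
qed

lemma partition_gf_empty: "partition_gf {} = 1"
proof (rule fps_ext)
  fix n
  have "part_multisets {} n = {M. M = {#} \<and> n = 0}" by (auto simp: part_multisets_def)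
  then show "partition_gf {} $ n = 1 $ n" by (cases "n = 0") (simp_all add: partition_gf_nth)
qed

lemma partition_gf_prod:
  "finite S \<Longrightarrow> 0 \<notin> S \<Longrightarrow> (\<Prod>k\<in>S. 1 - fps_X ^ k) * partition_gf S = 1"
proof (induction S rule: finite_induct)
  case (insert p S)
  have "(\<Prod>k\<in>insert p S. 1 - fps_X ^ k) * partition_gf (insert p S)
      = (\<Prod>k\<in>S. 1 - fps_X ^ k) * ((1 - fps_X ^ p) * partition_gf (insert p S))"
    using insert.hyps by (simp add: ac_simps)
  also have "\<dots> = 1"
    using partition_gf_remove[of p "insert p S"] insert by simp
  finally show ?case .
qed (simp add: partition_gf_empty)

lemma partition_gf_cong:
  assumes "S \<inter> {1..n} = T \<inter> {1..n}" "0 \<notin> S" "0 \<notin> T"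
  shows "partition_gf S $ n = partition_gf T $ n"
proof -
  have "x \<le> n" if "sum_mset M = n" "x \<in># M" for M x
    using that by (metis le_add1 multi_member_split sum_mset.add_mset)
  then have "part_multisets U n = part_multisets (U \<inter> {1..n}) n" if "0 \<notin> U" for U
    using that by (fastforce simp: part_multisets_def Suc_le_eq intro!: gr0I)
  then show ?thesis using assms by (metis partition_gf_nth)
qed

text \<open>
Factors \<open>1 - X\<^sup>k\<close> with \<open>k > n\<close> do not influence the coefficients up to \<open>n\<close>.
\<close>
lemma prod_one_minus_high:
  assumes "finite A" "\<And>k. k \<in> A \<Longrightarrow> n < k"
  shows "\<exists>w :: int fps. (\<Prod>k\<in>A. 1 - fps_X ^ k) = 1 + fps_X ^ Suc n * w"
  using assms
proof (induction A rule: finite_induct)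
  case empty
  have "(\<Prod>k\<in>{}. 1 - fps_X ^ k) = 1 + fps_X ^ Suc n * (0 :: int fps)" by simp
  then show ?case by blast
next
  case (insert k A)
  then obtain w where w: "(\<Prod>k\<in>A. 1 - fps_X ^ k) = 1 + fps_X ^ Suc n * (w :: int fps)" by auto
  obtain d where k: "k = Suc n + d" using insert.prems[of k] less_natE by (metis add_Suc insertI1)
  have "(\<Prod>k\<in>insert k A. 1 - fps_X ^ k) = 1 + fps_X ^ Suc n * (w - fps_X ^ d * (1 + fps_X ^ Suc n * w))"
    using insert.hyps by (simp add: w k power_add algebra_simps)
  then show ?case by blast
qed

text \<open>
Euler's theorem, from \<open>1 + X\<^sup>k = (1 - X\<^bsup>2k\<^esup>) / (1 - X\<^sup>k)\<close>. To compare the coefficients at \<open>n\<close> only the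
factors with \<open>k \<le> n\<close> are multiplied. The even numbers up to \<open>n\<close> then cancel between the numerators
and the denominators; the numerators left over have exponents above \<open>n\<close>, the denominators left
over are the odd numbers up to \<open>n\<close>.
\<close>
theorem distinct_gf_eq_partition_gf_odd: "distinct_gf {1..} = partition_gf {k. odd k}"
proof (rule fps_ext)
  fix n :: nat
  let ?P = "\<lambda>A. \<Prod>k\<in>A. 1 - fps_X ^ k :: int fps"
  let ?odd = "{k. k \<in> {1..n} \<and> odd k}" and ?even = "{k. k \<in> {1..n} \<and> even k}"
  let ?high = "{k. k \<in> {n<..2*n} \<and> even k}"
  have "?P ?even * partition_gf ?even = 1" by (rule partition_gf_prod) auto
  then have nonzero: "?P ?even \<noteq> 0" by (metis mult_zero_left zero_neq_one)
  have split: "?P {1..n} = ?P ?odd * ?P ?even"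
    by (subst prod.union_disjoint[symmetric]) (auto intro!: prod.cong)
  have double: "?P ((*) 2 ` {1..n}) = ?P ?even * ?P ?high"
  proof (subst prod.union_disjoint[symmetric])
    show "?P ((*) 2 ` {1..n}) = ?P (?even \<union> ?high)"
      by (rule prod.cong) (auto elim!: evenE)
  qed auto
  have "distinct_gf {1..n} * ?P {1..n} = (\<Prod>k\<in>{1..n}. 1 - fps_X ^ (2 * k))"
    by (simp add: distinct_gf_eq_prod mult_2 power_add algebra_simps del: mult_2_right flip: prod.distrib)
       (simp add: mult_2_right power_add)
  also have "\<dots> = ?P ((*) 2 ` {1..n})" by (subst prod.reindex) (auto simp: inj_on_def)
  finally have "?P ?even * (distinct_gf {1..n} * ?P ?odd) = ?P ?even * ?P ?high"
    by (simp only: split double ac_simps)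
  then have "distinct_gf {1..n} * ?P ?odd = ?P ?high"
    using nonzero by (simp only: mult_cancel_left) simp
  then have 1: "distinct_gf {1..n} * ?P ?odd * partition_gf ?odd = ?P ?high * partition_gf ?odd"
    by (rule arg_cong[where f = "\<lambda>x. x * partition_gf ?odd"])
  have 2: "?P ?odd * partition_gf ?odd = 1" by (intro partition_gf_prod) auto
  have cancel: "a = d" if "a * b * c = d" "b * c = 1" for a b c d :: "int fps"
    using that by (simp add: mult.assoc)
  have eq: "distinct_gf {1..n} = ?P ?high * partition_gf ?odd" by (rule cancel[OF 1 2])
  have "\<exists>w. ?P ?high = 1 + fps_X ^ Suc n * w" by (rule prod_one_minus_high) auto
  then obtain w where w: "?P ?high = 1 + fps_X ^ Suc n * w" by (rule exE)
  have "distinct_gf {1..} $ n = distinct_gf {1..n} $ n" by (rule distinct_gf_cong) auto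
  also have "\<dots> = partition_gf ?odd $ n"
  proof -
    have "(fps_X ^ Suc n * (w * partition_gf ?odd)) $ n = 0"
      by (subst fps_X_power_mult_nth) simp
    then show ?thesis
      unfolding eq w by (simp only: distrib_right mult.assoc mult_1_left fps_add_nth add_0_right)
  qed
  also have "\<dots> = partition_gf {k. odd k} $ n" by (rule partition_gf_cong) auto
  finally show "distinct_gf {1..} $ n = partition_gf {k. odd k} $ n" .
qed

section \<open>Hooks read off from column heights\<close>

text \<open>
The height of column \<open>v\<close> of the Young diagram.
\<close>
definition at_least :: "nat \<Rightarrow> nat list \<Rightarrow> nat" where
  "at_least v xs = length (filter (\<lambda>x. v \<le> x) xs)"

lemma part_conjugate_eq:
  assumes "xs \<in> partitions n" "1 \<le> j"
  shows "part (conjugate xs) j = at_least j xs"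
proof -
  have "{i. (i, j) \<in> young_diagram xs} = Suc ` {i. i < length xs \<and> j \<le> xs ! i}"
  proof (intro equalityI subsetI)
    fix i assume "i \<in> {i. (i, j) \<in> young_diagram xs}"
    then show "i \<in> Suc ` {i. i < length xs \<and> j \<le> xs ! i}"
      by (cases i) (auto simp: young_diagram_def Defs.part_def Suc_le_eq)
  qed (use assms in \<open>auto simp: young_diagram_def Defs.part_def\<close>)
  then have card: "card {i. (i, j) \<in> young_diagram xs} = at_least j xs"
    by (simp add: card_image at_least_def length_filter_conv_card)
  show ?thesis
  proof (cases "j \<le> part xs 1")
    case False
    have "part (conjugate xs) j = 0" using False by (simp add: part_conjugate)
    moreover have "\<not> 1 \<le> part (conjugate xs) j"
      using young_diagram_iff_conjugate[OF assms(1), of 1 j] assms(2) False by simp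
    moreover have "{i. (i, j) \<in> young_diagram xs} = {}"
    proof -
      have "part xs i < j" if "1 \<le> i" for i
        using part_antimono[OF assms(1), of 1 i] that False by simp
      then show ?thesis by (fastforce simp: young_diagram_def)
    qed
    ultimately show ?thesis using card by simp
  qed (use assms card in \<open>simp add: part_conjugate\<close>)
qed

lemma at_least_Suc: "at_least v xs = count (mset xs) v + at_least (Suc v) xs"
  by (induction xs) (auto simp: at_least_def)

text \<open>
The box \<open>(i, j)\<close> has leg \<open>l\<close> exactly if its column has height \<open>i + l\<close>, so \<open>l\<close> and \<open>j\<close> determine
\<open>i\<close>. That the arm is \<open>a\<close> means that row \<open>i\<close> reaches column \<open>j + a\<close> but not column
\<open>j + a + 1\<close>, that is, \<open>i\<close> lies between the heights of these columns. Counting hooks thus means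
counting columns. On the right the columns are numbered from 0.
\<close>
lemma card_hooks:
  assumes xs: "xs \<in> partitions n"
  shows "card {(i, j). (i, j) \<in> young_diagram xs \<and> part xs i = j + a \<and> part (conjugate xs) j = i + l}
    = card {j. at_least (j + a + 2) xs + l < at_least (j + 1) xs \<and> at_least (j + 1) xs \<le> at_least (j + a + 1) xs + l}"
    (is "card ?H = card ?J")
proof -
  have row: "v \<le> part xs i \<longleftrightarrow> i \<le> at_least v xs" if "1 \<le> i" "1 \<le> v" for i v
    using young_diagram_iff_conjugate[OF xs that] part_conjugate_eq[OF xs that(2)] by simp
  have "bij_betw (\<lambda>j. (at_least (j + 1) xs - l, j + 1)) ?J ?H"
  proof (rule bij_betw_byWitness[where f' = "\<lambda>(i, j). j - 1"])
    show "(\<lambda>j. (at_least (j + 1) xs - l, j + 1)) ` ?J \<subseteq> ?H"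
    proof (rule image_subsetI)
      fix j assume j: "j \<in> ?J"
      define i where "i = at_least (j + 1) xs - l"
      have i: "1 \<le> i" "at_least (j + 1) xs = i + l" using j by (auto simp: i_def)
      have "\<not> j + a + 2 \<le> part xs i" "j + a + 1 \<le> part xs i"
        using row[OF i(1), of "j + a + 2"] row[OF i(1), of "j + a + 1"] j i(2) by auto
      then have "part xs i = j + 1 + a" by simp
      moreover have "i \<le> length xs"
      proof (rule ccontr)
        assume "\<not> i \<le> length xs"
        then have "part xs i = 0" by (simp add: Defs.part_def)
        with calculation show False by simp
      qed
      ultimately show "(at_least (j + 1) xs - l, j + 1) \<in> ?H"
        using i part_conjugate_eq[OF xs, of "j + 1"] by (auto simp: young_diagram_def simp flip: i_def)
    qed
    show "(\<lambda>(i, j). j - 1) ` ?H \<subseteq> ?J"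
    proof (rule image_subsetI)
      fix b assume "b \<in> ?H"
      then obtain i j where b: "b = (i, j)" "(i, j) \<in> young_diagram xs" "part xs i = j + a"
        "part (conjugate xs) j = i + l" by auto
      then have ij: "1 \<le> i" "1 \<le> j" by (auto simp: young_diagram_def)
      have "at_least j xs = i + l" using b part_conjugate_eq[OF xs ij(2)] by simp
      moreover have "\<not> i \<le> at_least (j + a + 1) xs" "i \<le> at_least (j + a) xs"
        using row[OF ij(1), of "j + a + 1"] row[OF ij(1), of "j + a"] b(3) ij by auto
      ultimately show "(\<lambda>(i, j). j - 1) b \<in> ?J" using b(1) ij by (cases j) auto
    qed
    show "\<forall>b\<in>?H. (\<lambda>j. (at_least (j + 1) xs - l, j + 1)) ((\<lambda>(i, j). j - 1) b) = b"
      using part_conjugate_eq[OF xs] by (auto simp: young_diagram_def)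
  qed auto
  then show ?thesis by (rule bij_betw_same_card[symmetric])
qed

lemma num_hooks_eq:
  assumes xs: "xs \<in> partitions n"
  shows "num_hooks (Suc t) xs = (\<Sum>a\<le>t. card {j. at_least (j + a + 2) xs + (t - a) < at_least (j + 1) xs
      \<and> at_least (j + 1) xs \<le> at_least (j + a + 1) xs + (t - a)})"
proof -
  define H where "H a = {(i, j). (i, j) \<in> young_diagram xs \<and> part xs i = j + a \<and> part (conjugate xs) j = i + (t - a)}"
    for a
  have "{(i, j). (i, j) \<in> young_diagram xs \<and> hook_length xs i j = Suc t} = (\<Union>a\<le>t. H a)"
  proof (intro equalityI subsetI)
    fix b assume "b \<in> {(i, j). (i, j) \<in> young_diagram xs \<and> hook_length xs i j = Suc t}"
    then obtain i j where b: "b = (i, j)" "(i, j) \<in> young_diagram xs" "hook_length xs i j = Suc t" by auto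
    then have "1 \<le> i" "1 \<le> j" "j \<le> part xs i" by (auto simp: young_diagram_def)
    then have "i \<le> part (conjugate xs) j" using young_diagram_iff_conjugate[OF xs] by simp
    then have "part xs i - j \<le> t" "b \<in> H (part xs i - j)"
      using b \<open>j \<le> part xs i\<close> by (auto simp: H_def hook_length_def)
    then show "b \<in> (\<Union>a\<le>t. H a)" by blast
  qed (auto simp: H_def hook_length_def)
  then have "num_hooks (Suc t) xs = card (\<Union>a\<le>t. H a)" by (simp add: num_hooks_def)
  also have "\<dots> = (\<Sum>a\<le>t. card (H a))"
    by (rule card_UN_disjoint)
      (auto simp: H_def intro: finite_subset[OF _ finite_young_diagram[of xs]])
  finally show ?thesis by (simp only: H_def card_hooks[OF xs])
qed

text \<open>
With \<open>p = j + 1\<close> the last column of a part \<open>p\<close>: the vertical hooks belong to the repeated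
parts \<open>p\<close>, and the horizontal ones to the parts \<open>p + 1\<close> for which \<open>p\<close> is no part, since
consecutive column heights differ by the multiplicities of the parts.
\<close>
lemma num_hooks_2:
  assumes "xs \<in> partitions n"
  defines "c \<equiv> count (mset xs)"
  shows "num_hooks 2 xs = card {j. 2 \<le> c (j + 1)} + card {j. c (j + 1) = 0 \<and> 1 \<le> c (j + 2)}"
proof -
  have 1: "at_least (j + 1) xs = c (j + 1) + c (j + 2) + at_least (j + 3) xs"
    "at_least (j + 2) xs = c (j + 2) + at_least (j + 3) xs" for j
    using at_least_Suc[of "j + 1" xs] at_least_Suc[of "j + 2" xs]
    by (simp_all add: c_def eval_nat_numeral)
  have "{..1} = {0, 1::nat}" by auto
  then have "num_hooks 2 xs = card {j. at_least (j + 2) xs + 1 < at_least (j + 1) xs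
        \<and> at_least (j + 1) xs \<le> at_least (j + 1) xs + 1}
      + card {j. at_least (j + 3) xs < at_least (j + 1) xs \<and> at_least (j + 1) xs \<le> at_least (j + 2) xs}"
    using num_hooks_eq[OF assms(1), of 1] by (simp add: numeral_2_eq_2 eval_nat_numeral)
  moreover have "at_least (j + 2) xs + 1 < at_least (j + 1) xs
        \<and> at_least (j + 1) xs \<le> at_least (j + 1) xs + 1 \<longleftrightarrow> 2 \<le> c (j + 1)" for j
    unfolding 1 by auto
  moreover have "at_least (j + 3) xs < at_least (j + 1) xs \<and> at_least (j + 1) xs \<le> at_least (j + 2) xs
      \<longleftrightarrow> c (j + 1) = 0 \<and> 1 \<le> c (j + 2)" for j
    unfolding 1 by auto
  ultimately show ?thesis by presburger
qed

lemma num_hooks_3: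
  assumes "xs \<in> partitions n"
  defines "c \<equiv> count (mset xs)"
  shows "num_hooks 3 xs = card {j. 3 \<le> c (j + 1)}
    + card {j. c (j + 1) \<le> 1 \<and> 2 \<le> c (j + 1) + c (j + 2)}
    + card {j. c (j + 1) = 0 \<and> c (j + 2) = 0 \<and> 1 \<le> c (j + 3)}"
proof -
  have 1: "at_least (j + 1) xs = c (j + 1) + c (j + 2) + c (j + 3) + at_least (j + 4) xs"
    "at_least (j + 2) xs = c (j + 2) + c (j + 3) + at_least (j + 4) xs"
    "at_least (j + 3) xs = c (j + 3) + at_least (j + 4) xs" for j
    using at_least_Suc[of "j + 1" xs] at_least_Suc[of "j + 2" xs] at_least_Suc[of "j + 3" xs]
    by (simp_all add: c_def eval_nat_numeral)
  have "{..2} = {0, 1, 2::nat}" by auto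
  then have "num_hooks 3 xs = card {j. at_least (j + 2) xs + 2 < at_least (j + 1) xs
        \<and> at_least (j + 1) xs \<le> at_least (j + 1) xs + 2}
      + card {j. at_least (j + 3) xs + 1 < at_least (j + 1) xs
        \<and> at_least (j + 1) xs \<le> at_least (j + 2) xs + 1}
      + card {j. at_least (j + 4) xs < at_least (j + 1) xs \<and> at_least (j + 1) xs \<le> at_least (j + 3) xs}"
    using num_hooks_eq[OF assms(1), of 2] by (simp add: numeral_3_eq_3 eval_nat_numeral)
  moreover have "at_least (j + 2) xs + 2 < at_least (j + 1) xs
        \<and> at_least (j + 1) xs \<le> at_least (j + 1) xs + 2 \<longleftrightarrow> 3 \<le> c (j + 1)" for j
    unfolding 1 by auto
  moreover have "at_least (j + 3) xs + 1 < at_least (j + 1) xs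
        \<and> at_least (j + 1) xs \<le> at_least (j + 2) xs + 1 \<longleftrightarrow> c (j + 1) \<le> 1 \<and> 2 \<le> c (j + 1) + c (j + 2)" for j
    unfolding 1 by auto
  moreover have "at_least (j + 4) xs < at_least (j + 1) xs \<and> at_least (j + 1) xs \<le> at_least (j + 3) xs
      \<longleftrightarrow> c (j + 1) = 0 \<and> c (j + 2) = 0 \<and> 1 \<le> c (j + 3)" for j
    unfolding 1 by auto
  ultimately show ?thesis by presburger
qed

section \<open>Generating functions of the hook counts\<close>

text \<open>
Double counting: the hooks of all partitions are sorted by the column in which they occur.
\<close>
lemma sum_card_swap:
  assumes "finite A" and "\<And>x j. x \<in> A \<Longrightarrow> P x j \<Longrightarrow> j \<le> (n :: nat)"
  shows "(\<Sum>x\<in>A. card {j. P x j}) = (\<Sum>j\<le>n. card {x \<in> A. P x j})"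
proof -
  have "(\<Sum>x\<in>A. card {j. P x j}) = (\<Sum>x\<in>A. card {j \<in> {..n}. P x j})"
    using assms(2) by (intro sum.cong refl arg_cong[where f = card]) auto
  also have "\<dots> = (\<Sum>x\<in>A. \<Sum>j\<le>n. of_bool (P x j))"
    by (simp add: sum.If_cases of_bool_def Int_def)
  also have "\<dots> = (\<Sum>j\<le>n. \<Sum>x\<in>A. of_bool (P x j))" by (rule sum.swap)
  also have "\<dots> = (\<Sum>j\<le>n. card {x \<in> A. P x j})"
    using assms(1) by (simp add: sum.If_cases of_bool_def Int_def)
  finally show ?thesis .
qed

lemma mem_partitions_le: "xs \<in> partitions n \<Longrightarrow> p \<in> set xs \<Longrightarrow> p \<le> n"
  using member_le_sum_list[of p xs] by (auto simp: partitions_def)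

lemma card_distinct_partitions:
  "card {xs \<in> distinct_partitions n. P (set xs)} = card {B \<in> part_sets {1..} n. P B}"
proof -
  let ?X = "{xs \<in> distinct_partitions n. P (set xs)}" and ?Y = "{B \<in> part_sets {1..} n. P B}"
  have inj: "inj_on set ?X"
  proof (rule inj_onI)
    fix xs ys assume "xs \<in> ?X" "ys \<in> ?X" "set xs = set ys"
    then have "mset xs = mset ys" "xs \<in> partitions n" "ys \<in> partitions n"
      using set_eq_iff_mset_eq_distinct[of xs ys] by (simp_all add: distinct_partitions_def)
    then show "xs = ys" using inj_on_mset_partitions by (metis inj_onD)
  qed
  have image: "set ` ?X = ?Y"
  proof (intro equalityI subsetI)
    fix B assume B: "B \<in> ?Y"
    define xs where "xs = rev (sorted_list_of_set B)"
    have xs: "set xs = B" "distinct xs" "sorted_wrt (\<ge>) xs"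
      using B by (auto simp: xs_def part_sets_def sorted_wrt_rev)
    have "sum_list xs = n"
      using B sum_list_distinct_conv_sum_set[OF xs(2), of "\<lambda>x. x"] xs(1)
      by (simp add: part_sets_def)
    then have "xs \<in> ?X"
      using B xs by (auto simp: distinct_partitions_def partitions_def part_sets_def Suc_le_eq)
    then show "B \<in> set ` ?X" by (rule rev_image_eqI) (simp add: xs)
  next
    fix B assume "B \<in> set ` ?X"
    then obtain xs where xs: "xs \<in> ?X" "B = set xs" by (elim imageE)
    then show "B \<in> ?Y"
      using sum_list_distinct_conv_sum_set[of xs "\<lambda>x. x"]
      by (auto simp: distinct_partitions_def partitions_def part_sets_def Suc_le_eq)
  qed
  show ?thesis by (simp only: card_image[OF inj] flip: image)
qed

lemma card_odd_partitions:
  "card {xs \<in> odd_partitions n. P (mset xs)} = card {M \<in> part_multisets {k. odd k} n. P M}"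
proof -
  let ?X = "{xs \<in> odd_partitions n. P (mset xs)}"
  have inj: "inj_on mset ?X"
    using inj_on_mset_partitions by (rule inj_on_subset) (auto simp: odd_partitions_def)
  have "{xs \<in> partitions n. set xs \<subseteq> {k. odd k}} = odd_partitions n"
    by (auto simp: odd_partitions_def)
  then have odd: "mset ` odd_partitions n = part_multisets {k. odd k} n"
    using mset_image_partitions[of "{k. odd k}" n] by simp
  have "mset ` ?X = {M \<in> mset ` odd_partitions n. P M}" by auto
  then have image: "mset ` ?X = {M \<in> part_multisets {k. odd k} n. P M}" by (simp only: odd)
  show ?thesis by (simp only: card_image[OF inj] flip: image)
qed

abbreviation avoiding :: "nat set \<Rightarrow> int fps" where
  "avoiding A \<equiv> distinct_gf ({1..} - A)"

lemma card_part_sets_avoiding: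
  assumes "p \<notin> A" "0 < p"
  shows "int (card {B \<in> part_sets {1..} n. p \<in> B \<and> B \<inter> A = {}})
    = (fps_X ^ p * avoiding (insert p A)) $ n"
proof -
  have "{B \<in> part_sets {1..} n. p \<in> B \<and> B \<inter> A = {}} = {B \<in> part_sets ({1..} - A) n. p \<in> B}"
    by (auto simp: part_sets_def)
  moreover have "{1..} - A - {p} = {1..} - insert p A" by auto
  ultimately show ?thesis
    using card_part_sets_containing[of p "{1..} - A" n] assms by simp
qed

lemma count_mset_distinct_partitions:
  "xs \<in> distinct_partitions n \<Longrightarrow> count (mset xs) p = of_bool (p \<in> set xs)"
  by (simp add: distinct_partitions_def distinct_count_atmost_1 of_bool_def)

lemma sum_distinct_partitions:
  assumes "\<And>xs j. xs \<in> distinct_partitions n \<Longrightarrow> P (set xs) j \<Longrightarrow> j \<le> n"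
    and "\<And>j. int (card {B \<in> part_sets {1..} n. P B j}) = f j $ n"
  shows "int (\<Sum>xs\<in>distinct_partitions n. card {j. P (set xs) j}) = fps_sum f $ n"
proof -
  have "(\<Sum>xs\<in>distinct_partitions n. card {j. P (set xs) j}) = (\<Sum>j\<le>n. card {xs \<in> distinct_partitions n. P (set xs) j})"
    by (rule sum_card_swap[OF finite_distinct_partitions, of n "\<lambda>xs. P (set xs)" n, OF assms(1)])
  also have "\<dots> = (\<Sum>j\<le>n. card {B \<in> part_sets {1..} n. P B j})"
    using card_distinct_partitions[of n "\<lambda>B. P B j" for j] by (intro sum.cong refl)
  finally show ?thesis by (simp only: fps_sum_nth of_nat_sum assms(2))
qed

lemma sum_odd_partitions:
  assumes "\<And>xs j. xs \<in> odd_partitions n \<Longrightarrow> P (mset xs) j \<Longrightarrow> j \<le> n"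
    and "\<And>j. int (card {M \<in> part_multisets {k. odd k} n. P M j}) = f j $ n"
  shows "int (\<Sum>xs\<in>odd_partitions n. card {j. P (mset xs) j}) = fps_sum f $ n"
proof -
  have "(\<Sum>xs\<in>odd_partitions n. card {j. P (mset xs) j}) = (\<Sum>j\<le>n. card {xs \<in> odd_partitions n. P (mset xs) j})"
    by (rule sum_card_swap[OF finite_odd_partitions, of n "\<lambda>xs. P (mset xs)" n, OF assms(1)])
  also have "\<dots> = (\<Sum>j\<le>n. card {M \<in> part_multisets {k. odd k} n. P M j})"
    using card_odd_partitions[of n "\<lambda>M. P M j" for j] by (intro sum.cong refl)
  finally show ?thesis by (simp only: fps_sum_nth of_nat_sum assms(2))
qed

text \<open>
Counts, over all distinct partitions, the parts \<open>p = j + 2\<close> for which \<open>p - 1\<close> is no part.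
\<close>
definition gaps2 :: "int fps" where
  "gaps2 = fps_sum (\<lambda>j. fps_X ^ (j + 2) * avoiding {j + 1, j + 2})"

text \<open>
Counts, over all distinct partitions, the parts \<open>p = j + 3\<close> for which \<open>p - 1\<close> and \<open>p - 2\<close> are no parts.
\<close>
definition gaps3 :: "int fps" where
  "gaps3 = fps_sum (\<lambda>j. fps_X ^ (j + 3) * avoiding {j + 1, j + 2, j + 3})"

text \<open>
Counts, over all distinct partitions, the parts \<open>p = j + 2\<close>.
\<close>
definition parts_ge_2 :: "int fps" where
  "parts_ge_2 = fps_sum (\<lambda>j. fps_X ^ (j + 2) * avoiding {j + 2})"

lemma hooks_distinct_2: "int (hooks_distinct 2 n) = gaps2 $ n"
proof -
  have "num_hooks 2 xs = card {j. j + 2 \<in> set xs \<and> set xs \<inter> {j + 1} = {}}" if "xs \<in> distinct_partitions n" for xs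
  proof -
    have "{j. 2 \<le> count (mset xs) (j + 1)} = {}"
      by (simp add: count_mset_distinct_partitions[OF that] of_bool_def)
    moreover have "count (mset xs) (j + 1) = 0 \<and> 1 \<le> count (mset xs) (j + 2)
        \<longleftrightarrow> j + 2 \<in> set xs \<and> set xs \<inter> {j + 1} = {}" for j
      by (auto simp: count_mset_distinct_partitions[OF that])
    moreover have "xs \<in> partitions n" using that by (simp add: distinct_partitions_def)
    ultimately show ?thesis using num_hooks_2[of xs n] by simp
  qed
  then have "hooks_distinct 2 n
      = (\<Sum>xs\<in>distinct_partitions n. card {j. j + 2 \<in> set xs \<and> set xs \<inter> {j + 1} = {}})"
    unfolding hooks_distinct_def by (rule sum.cong[OF refl])
  also have "int \<dots> = gaps2 $ n"
    unfolding gaps2_def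
  proof (rule sum_distinct_partitions)
    show "int (card {B \<in> part_sets {1..} n. j + 2 \<in> B \<and> B \<inter> {j + 1} = {}})
        = (fps_X ^ (j + 2) * avoiding {j + 1, j + 2}) $ n" for j
      using card_part_sets_avoiding[of "j + 2" "{j + 1}" n] by (simp only: insert_commute) simp
    show "j \<le> n" if "xs \<in> distinct_partitions n" "j + 2 \<in> set xs \<and> set xs \<inter> {j + 1} = {}" for xs j
      using mem_partitions_le[of xs n "j + 2"] that by (simp add: distinct_partitions_def)
  qed
  finally show ?thesis .
qed

text \<open>
The hooks with arm 1 and leg 1 correspond to the pairs of consecutive parts. A part \<open>p \<ge> 2\<close> has
its predecessor among the parts unless it is counted by \<open>gaps2\<close>.
\<close>
lemma hooks_distinct_3: "int (hooks_distinct 3 n) = (parts_ge_2 - gaps2 + gaps3) $ n"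
proof -
  let ?pair = "\<lambda>B j. j + 1 \<in> B \<and> j + 2 \<in> B"
  let ?gap = "\<lambda>B j. j + 3 \<in> B \<and> B \<inter> {j + 1, j + 2} = {}"
  have "num_hooks 3 xs = card {j. ?pair (set xs) j} + card {j. ?gap (set xs) j}"
    if "xs \<in> distinct_partitions n" for xs
  proof -
    have "{j. 3 \<le> count (mset xs) (j + 1)} = {}"
      by (simp add: count_mset_distinct_partitions[OF that] of_bool_def)
    moreover have "count (mset xs) (j + 1) \<le> 1 \<and> 2 \<le> count (mset xs) (j + 1) + count (mset xs) (j + 2)
        \<longleftrightarrow> ?pair (set xs) j" for j
      by (auto simp: count_mset_distinct_partitions[OF that])
    moreover have "count (mset xs) (j + 1) = 0 \<and> count (mset xs) (j + 2) = 0 \<and> 1 \<le> count (mset xs) (j + 3)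
        \<longleftrightarrow> ?gap (set xs) j" for j
      by (auto simp: count_mset_distinct_partitions[OF that])
    moreover have "xs \<in> partitions n" using that by (simp add: distinct_partitions_def)
    ultimately show ?thesis using num_hooks_3[of xs n] by simp
  qed
  then have "hooks_distinct 3 n = (\<Sum>xs\<in>distinct_partitions n. card {j. ?pair (set xs) j} + card {j. ?gap (set xs) j})"
    unfolding hooks_distinct_def by (rule sum.cong[OF refl])
  also have "\<dots> = (\<Sum>xs\<in>distinct_partitions n. card {j. ?pair (set xs) j})
      + (\<Sum>xs\<in>distinct_partitions n. card {j. ?gap (set xs) j})"
    by (rule sum.distrib)
  finally have split: "int (hooks_distinct 3 n) = int (\<Sum>xs\<in>distinct_partitions n. card {j. ?pair (set xs) j})
      + int (\<Sum>xs\<in>distinct_partitions n. card {j. ?gap (set xs) j})"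
    by simp
  have "int (\<Sum>xs\<in>distinct_partitions n. card {j. ?pair (set xs) j}) = (parts_ge_2 - gaps2) $ n"
    unfolding parts_ge_2_def gaps2_def fps_sum_diff[symmetric]
  proof (rule sum_distinct_partitions)
    fix j
    have "{B \<in> part_sets {1..} n. j + 2 \<in> B \<and> B \<inter> {} = {}}
        = {B \<in> part_sets {1..} n. ?pair B j} \<union> {B \<in> part_sets {1..} n. j + 2 \<in> B \<and> B \<inter> {j + 1} = {}}"
      by auto
    then have "card {B \<in> part_sets {1..} n. j + 2 \<in> B \<and> B \<inter> {} = {}}
        = card {B \<in> part_sets {1..} n. ?pair B j}
          + card {B \<in> part_sets {1..} n. j + 2 \<in> B \<and> B \<inter> {j + 1} = {}}"
      by (simp only:) (rule card_Un_disjoint, auto simp: finite_part_sets)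
    then show "int (card {B \<in> part_sets {1..} n. ?pair B j})
        = (fps_X ^ (j + 2) * avoiding {j + 2} - fps_X ^ (j + 2) * avoiding {j + 1, j + 2}) $ n"
      using card_part_sets_avoiding[of "j + 2" "{}" n] card_part_sets_avoiding[of "j + 2" "{j + 1}" n]
      by (simp only: insert_commute[of "j + 1"] fps_sub_nth) simp
  next
    show "j \<le> n" if "xs \<in> distinct_partitions n" "?pair (set xs) j" for xs j
      using mem_partitions_le[of xs n "j + 2"] that by (simp add: distinct_partitions_def)
  qed
  moreover have "int (\<Sum>xs\<in>distinct_partitions n. card {j. ?gap (set xs) j}) = gaps3 $ n"
    unfolding gaps3_def
  proof (rule sum_distinct_partitions)
    show "int (card {B \<in> part_sets {1..} n. ?gap B j})
        = (fps_X ^ (j + 3) * avoiding {j + 1, j + 2, j + 3}) $ n" for j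
    proof -
      have "insert (j + 3) {j + 1, j + 2} = {j + 1, j + 2, j + 3}" by auto
      then show ?thesis
        using card_part_sets_avoiding[of "j + 3" "{j + 1, j + 2}" n] by simp
    qed
    show "j \<le> n" if "xs \<in> distinct_partitions n" "?gap (set xs) j" for xs j
      using mem_partitions_le[of xs n "j + 3"] that by (simp add: distinct_partitions_def)
  qed
  ultimately show ?thesis using split by simp
qed

abbreviation odd_gf :: "int fps" where
  "odd_gf \<equiv> partition_gf {k. odd k}"

lemma count_odd_partition: "M \<in> part_multisets {k. odd k} n \<Longrightarrow> even p \<Longrightarrow> count M p = 0"
  by (auto simp: part_multisets_def count_eq_zero_iff)

lemma mem_odd_partitions_le:
  assumes "xs \<in> odd_partitions n" "0 < count (mset xs) p"
  shows "p \<le> n"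
  using mem_partitions_le[of xs n p] assms by (simp add: odd_partitions_def count_greater_zero_iff)

text \<open>
The vertical hooks of length \<open>m\<close>: they belong to the odd numbers of multiplicity at least \<open>m\<close>.
\<close>
lemma hooks_odd_repeated:
  assumes "1 \<le> m"
  shows "int (\<Sum>xs\<in>odd_partitions n. card {j. m \<le> count (mset xs) (j + 1)}) = progression m (2 * m) odd_gf $ n"
proof -
  have "int (\<Sum>xs\<in>odd_partitions n. card {j. m \<le> count (mset xs) (j + 1)})
      = fps_sum (\<lambda>j. if even j then fps_X ^ (m * (j + 1)) * odd_gf else 0) $ n"
  proof (rule sum_odd_partitions)
    show "int (card {M \<in> part_multisets {k. odd k} n. m \<le> count M (j + 1)})
        = (if even j then fps_X ^ (m * (j + 1)) * odd_gf else 0) $ n" for j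
    proof (cases "even j")
      case True
      then show ?thesis using card_part_multisets_count[of "j + 1" "{k. odd k}" n m] by simp
    next
      case False
      then have "{M \<in> part_multisets {k. odd k} n. m \<le> count M (j + 1)} = {}"
        using assms by (auto simp: count_odd_partition)
      with False show ?thesis by (simp only: card.empty) simp
    qed
    show "j \<le> n" if "xs \<in> odd_partitions n" "m \<le> count (mset xs) (j + 1)" for xs j
    proof -
      have "0 < count (mset xs) (j + 1)" using that assms by linarith
      then show ?thesis using mem_odd_partitions_le[OF that(1)] by force
    qed
  qed
  also have "\<dots> = progression m (2 * m) odd_gf $ n"
  proof (rule arg_cong[where f = "\<lambda>f. f $ n"], rule fps_sum_progression_even)
    show "j \<le> m * (j + 1)" for j using mult_le_mono1[OF assms, of "j + 1"] by simp
    show "m + 2 * m * i = m * (2 * i + 1)" for i by simp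
  qed
  finally show ?thesis .
qed

lemma hooks_odd_2: "int (hooks_odd 2 n) = (progression 2 4 odd_gf + progression 3 2 odd_gf) $ n"
proof -
  let ?gap = "\<lambda>M j. count M (j + 1) = 0 \<and> 1 \<le> count M (j + 2)"
  have "hooks_odd 2 n
      = (\<Sum>xs\<in>odd_partitions n. card {j. 2 \<le> count (mset xs) (j + 1)} + card {j. ?gap (mset xs) j})"
    unfolding hooks_odd_def by (rule sum.cong[OF refl], rule num_hooks_2) (auto simp: odd_partitions_def)
  also have "\<dots> = (\<Sum>xs\<in>odd_partitions n. card {j. 2 \<le> count (mset xs) (j + 1)})
      + (\<Sum>xs\<in>odd_partitions n. card {j. ?gap (mset xs) j})"
    by (rule sum.distrib)
  finally have split: "int (hooks_odd 2 n) = int (\<Sum>xs\<in>odd_partitions n. card {j. 2 \<le> count (mset xs) (j + 1)})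
      + int (\<Sum>xs\<in>odd_partitions n. card {j. ?gap (mset xs) j})"
    by simp
  have "int (\<Sum>xs\<in>odd_partitions n. card {j. ?gap (mset xs) j})
      = fps_sum (\<lambda>j. if odd j then fps_X ^ (j + 2) * odd_gf else 0) $ n"
  proof (rule sum_odd_partitions)
    show "int (card {M \<in> part_multisets {k. odd k} n. ?gap M j})
        = (if odd j then fps_X ^ (j + 2) * odd_gf else 0) $ n" for j
    proof (cases "even j")
      case False
      then have "{M \<in> part_multisets {k. odd k} n. ?gap M j} = {M \<in> part_multisets {k. odd k} n. 1 \<le> count M (j + 2)}"
        by (auto simp: count_odd_partition)
      then show ?thesis using False card_part_multisets_count[of "j + 2" "{k. odd k}" n 1] by simp
    next
      case True
      then have "{M \<in> part_multisets {k. odd k} n. ?gap M j} = {}"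
        using count_odd_partition[of _ n "j + 2"] by fastforce
      with True show ?thesis by (simp only: card.empty) simp
    qed
    show "j \<le> n" if "xs \<in> odd_partitions n" "?gap (mset xs) j" for xs j
      using mem_odd_partitions_le[of xs n "j + 2"] that by simp
  qed
  also have "\<dots> = progression 3 2 odd_gf $ n"
    by (subst fps_sum_progression_odd[where a = 3 and k = 2]) auto
  finally show ?thesis using split hooks_odd_repeated[of 2 n] by simp
qed

text \<open>
The parts \<open>p\<close> with \<open>p - 2\<close> no part contribute \<open>X\<^sup>p (1 - X\<^bsup>p-2\<^esup>)\<close>, whence the difference of two
progressions; the square hooks with arm 1 and leg 1 belong to the repeated parts \<open>p \<ge> 3\<close>.
\<close>
lemma hooks_odd_3: "int (hooks_odd 3 n)
    = (progression 3 6 odd_gf + progression 6 4 odd_gf + (progression 3 2 odd_gf - progression 4 4 odd_gf)) $ n"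
proof -
  let ?S = "{k. odd k} :: nat set"
  let ?square = "\<lambda>M j. count M (j + 1) \<le> 1 \<and> 2 \<le> count M (j + 1) + count M (j + 2)"
  let ?gap = "\<lambda>M j. count M (j + 1) = 0 \<and> count M (j + 2) = 0 \<and> 1 \<le> count M (j + 3)"
  have "hooks_odd 3 n
      = (\<Sum>xs\<in>odd_partitions n. card {j. 3 \<le> count (mset xs) (j + 1)} + card {j. ?square (mset xs) j}
          + card {j. ?gap (mset xs) j})"
    unfolding hooks_odd_def by (rule sum.cong[OF refl], rule num_hooks_3) (auto simp: odd_partitions_def)
  also have "\<dots> = (\<Sum>xs\<in>odd_partitions n. card {j. 3 \<le> count (mset xs) (j + 1)})
      + (\<Sum>xs\<in>odd_partitions n. card {j. ?square (mset xs) j})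
      + (\<Sum>xs\<in>odd_partitions n. card {j. ?gap (mset xs) j})"
    by (simp only: sum.distrib)
  finally have split: "int (hooks_odd 3 n) = int (\<Sum>xs\<in>odd_partitions n. card {j. 3 \<le> count (mset xs) (j + 1)})
      + int (\<Sum>xs\<in>odd_partitions n. card {j. ?square (mset xs) j})
      + int (\<Sum>xs\<in>odd_partitions n. card {j. ?gap (mset xs) j})"
    by simp
  have "int (\<Sum>xs\<in>odd_partitions n. card {j. ?square (mset xs) j})
      = fps_sum (\<lambda>j. if odd j then fps_X ^ (2 * (j + 2)) * odd_gf else 0) $ n"
  proof (rule sum_odd_partitions)
    show "int (card {M \<in> part_multisets ?S n. ?square M j})
        = (if odd j then fps_X ^ (2 * (j + 2)) * odd_gf else 0) $ n" for j
    proof (cases "even j")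
      case False
      then have "{M \<in> part_multisets ?S n. ?square M j} = {M \<in> part_multisets ?S n. 2 \<le> count M (j + 2)}"
        by (auto simp: count_odd_partition)
      then show ?thesis using False card_part_multisets_count[of "j + 2" ?S n 2] by simp
    next
      case True
      then have "{M \<in> part_multisets ?S n. ?square M j} = {}"
        using count_odd_partition[of _ n "j + 2"] by fastforce
      with True show ?thesis by (simp only: card.empty) simp
    qed
    show "j \<le> n" if "xs \<in> odd_partitions n" "?square (mset xs) j" for xs j
    proof -
      have "0 < count (mset xs) (j + 2)" using that(2) by linarith
      then show ?thesis using mem_odd_partitions_le[OF that(1)] by force
    qed
  qed
  also have "\<dots> = progression 6 4 odd_gf $ n"
    by (subst fps_sum_progression_odd[where a = 6 and k = 4]) auto
  finally have square: "int (\<Sum>xs\<in>odd_partitions n. card {j. ?square (mset xs) j}) = progression 6 4 odd_gf $ n" .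
  have "int (\<Sum>xs\<in>odd_partitions n. card {j. ?gap (mset xs) j})
      = fps_sum (\<lambda>j. (if even j then fps_X ^ (j + 3) * odd_gf else 0)
          - (if even j then fps_X ^ (2 * j + 4) * odd_gf else 0)) $ n"
  proof (rule sum_odd_partitions)
    show "int (card {M \<in> part_multisets ?S n. ?gap M j})
        = ((if even j then fps_X ^ (j + 3) * odd_gf else 0) - (if even j then fps_X ^ (2 * j + 4) * odd_gf else 0)) $ n" for j
    proof (cases "even j")
      case True
      then have "{M \<in> part_multisets ?S n. ?gap M j}
          = {M \<in> part_multisets (?S - {j + 1}) n. 1 \<le> count M (j + 3)}"
        by (auto simp: part_multisets_def count_eq_zero_iff)
      then have "int (card {M \<in> part_multisets ?S n. ?gap M j})
          = (fps_X ^ (j + 3) * partition_gf (?S - {j + 1})) $ n"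
        using True card_part_multisets_count[of "j + 3" "?S - {j + 1}" n 1] by simp
      also have "partition_gf (?S - {j + 1}) = (1 - fps_X ^ (j + 1)) * odd_gf"
        using True by (intro partition_gf_remove[symmetric]) auto
      also have "fps_X ^ (j + 3) * ((1 - fps_X ^ (j + 1)) * odd_gf)
          = fps_X ^ (j + 3) * odd_gf - fps_X ^ ((j + 3) + (j + 1)) * odd_gf"
        unfolding power_add[of _ "j + 3" "j + 1"]
          by (simp only: left_diff_distrib right_diff_distrib mult_1_left mult.assoc)
      also have "(j + 3) + (j + 1) = 2 * j + 4" by simp
      finally show ?thesis using True by simp
    next
      case False
      then have "{M \<in> part_multisets ?S n. ?gap M j} = {}"
        using count_odd_partition[of _ n "j + 3"] by fastforce
      with False show ?thesis by (simp only: card.empty) simp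
    qed
    show "j \<le> n" if "xs \<in> odd_partitions n" "?gap (mset xs) j" for xs j
      using mem_odd_partitions_le[of xs n "j + 3"] that by simp
  qed
  also have "\<dots> = (progression 3 2 odd_gf - progression 4 4 odd_gf) $ n"
    unfolding fps_sum_diff
    by (subst fps_sum_progression_even[where a = 3 and k = 2], simp, simp,
        subst fps_sum_progression_even[where a = 4 and k = 4], simp_all)
  finally show ?thesis using split square hooks_odd_repeated[of 3 n] by simp
qed

section \<open>Distinct partitions without the part 1\<close>

abbreviation no_ones :: "int fps" where
  "no_ones \<equiv> distinct_gf {2..}"

lemma no_ones_step: "0 < m \<Longrightarrow> no_ones $ m \<le> no_ones $ Suc m"
  using distinct_gf_shift_le[of "{2..}" 1 m] by simp

text \<open>
If the largest part \<open>M\<close> can be lowered by 1 without meeting another part, this gives a partition of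
\<open>m - 1\<close>; the result contains the part 1 only for \<open>m = 2\<close>. Otherwise \<open>M\<close> and \<open>M - 1\<close> are both parts; replacing these two by the single part
\<open>2M - 6\<close> gives a partition of \<open>m - 5\<close>. For \<open>M \<ge> 5\<close> the new part exceeds all others, so it reveals \<open>M\<close>. For
\<open>M \<le> 4\<close> the sum is at most \<open>2 + 3 + 4 = 9\<close>, which explains the bound on \<open>m\<close>.
\<close>
lemma no_ones_le_add:
  assumes "10 \<le> m"
  shows "no_ones $ m \<le> no_ones $ (m - 1) + no_ones $ (m - 5)"
proof -
  let ?P = "part_sets {2..}"
  define A1 where "A1 = {B \<in> ?P m. Max B - 1 \<notin> B}"
  define A2 where "A2 = {B \<in> ?P m. Max B - 1 \<in> B}"
  define f1 where "f1 B = insert (Max B - 1) (B - {Max B})" for B :: "nat set"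
  define g1 where "g1 B = insert (Max B + 1) (B - {Max B})" for B :: "nat set"
  define f2 where "f2 B = insert (2 * Max B - 6) (B - {Max B, Max B - 1})" for B :: "nat set"
  define g2 where "g2 B = {Max B div 2 + 3, Max B div 2 + 2} \<union> (B - {Max B})" for B :: "nat set"
  have fin: "finite B \<and> B \<subseteq> {2..} \<and> \<Sum>B = m \<and> Max B \<in> B" if "B \<in> ?P m" for B
  proof -
    have "B \<noteq> {}" using that assms by (auto simp: part_sets_def)
    with that show ?thesis by (simp add: part_sets_def)
  qed
  have "card A1 \<le> card (?P (m - 1))"
  proof (rule card_inj_on_le[of f1])
    have f1: "Max (f1 B) = Max B - 1 \<and> f1 B - {Max B - 1} = B - {Max B} \<and> f1 B \<in> ?P (m - 1)
        \<and> 3 \<le> Max B" if "B \<in> A1" for B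
    proof -
      from that have B: "finite B" "B \<subseteq> {2..}" "\<Sum>B = m" "Max B \<in> B" "Max B - 1 \<notin> B"
        using fin[of B] by (auto simp: A1_def)
      have less: "x < Max B - 1" if "x \<in> B - {Max B}" for x
      proof -
        have "x \<le> Max B" "x \<noteq> Max B" "x \<noteq> Max B - 1" using that B by auto
        then show ?thesis by linarith
      qed
      have "2 \<le> Max B" using B by auto
      have three: "3 \<le> Max B"
      proof (rule ccontr)
        assume "\<not> 3 \<le> Max B"
        with \<open>2 \<le> Max B\<close> have "Max B = 2" by simp
        then have "B = {2}" using B less by force
        with B assms show False by simp
      qed
      have max: "Max (f1 B) = Max B - 1"
        unfolding f1_def using B less by (intro Max_eqI) (auto dest: less_imp_le)
      have notin: "Max B - 1 \<notin> B - {Max B}" using less by blast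
      have "\<Sum>(f1 B) = Max B - 1 + \<Sum>(B - {Max B})" using B notin by (simp add: f1_def)
      moreover have "m = Max B + \<Sum>(B - {Max B})" using B sum.remove[of B "Max B" "\<lambda>x. x"] by simp
      ultimately have "\<Sum>(f1 B) = m - 1" using three by simp
      then have "f1 B \<in> ?P (m - 1)" using B three by (auto simp: part_sets_def f1_def)
      with max notin three show ?thesis by (simp add: f1_def)
    qed
    show "inj_on f1 A1"
    proof (rule inj_on_inverseI[of _ g1])
      fix B assume "B \<in> A1"
      then show "g1 (f1 B) = B" using f1[of B] fin[of B] by (simp add: g1_def A1_def insert_absorb)
    qed
    show "f1 ` A1 \<subseteq> ?P (m - 1)" using f1 by blast
  qed (simp add: finite_part_sets)
  moreover have "card A2 \<le> card (?P (m - 5))"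
  proof (rule card_inj_on_le[of f2])
    have f2: "Max (f2 B) = 2 * Max B - 6 \<and> f2 B - {2 * Max B - 6} = B - {Max B, Max B - 1}
        \<and> f2 B \<in> ?P (m - 5) \<and> 5 \<le> Max B" if "B \<in> A2" for B
    proof -
      from that have B: "finite B" "B \<subseteq> {2..}" "\<Sum>B = m" "Max B \<in> B" "Max B - 1 \<in> B"
        using fin[of B] by (auto simp: A2_def)
      have less: "x < Max B - 1" if "x \<in> B - {Max B, Max B - 1}" for x
      proof -
        have "x \<le> Max B" "x \<noteq> Max B" "x \<noteq> Max B - 1" using that B by auto
        then show ?thesis by linarith
      qed
      have five: "5 \<le> Max B"
      proof (rule ccontr)
        assume "\<not> 5 \<le> Max B"
        have "B \<subseteq> {2..4}"
        proof
          fix x assume "x \<in> B"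
          then have "x \<le> Max B" "2 \<le> x" using B by auto
          with \<open>\<not> 5 \<le> Max B\<close> show "x \<in> {2..4}" by simp
        qed
        then have "\<Sum>B \<le> \<Sum>{2..4}" by (intro sum_mono2) auto
        moreover have "\<Sum>{2..4} = (9::nat)" by (simp add: eval_nat_numeral)
        ultimately have "\<Sum>B \<le> 9" by simp
        with B assms show False by simp
      qed
      have max: "Max (f2 B) = 2 * Max B - 6"
        unfolding f2_def using B less five by (intro Max_eqI) fastforce+
      have notin: "2 * Max B - 6 \<notin> B - {Max B, Max B - 1}" using less five by fastforce
      have "\<Sum>(f2 B) = 2 * Max B - 6 + \<Sum>(B - {Max B, Max B - 1})" using B notin by (simp add: f2_def)
      moreover have "m = Max B + (Max B - 1 + \<Sum>(B - {Max B, Max B - 1}))"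
      proof -
        have "Max B - 1 \<in> B - {Max B}" using B five by auto
        then have "\<Sum>(B - {Max B}) = Max B - 1 + \<Sum>(B - {Max B} - {Max B - 1})"
          using B(1) by (intro sum.remove) auto
        moreover have "B - {Max B} - {Max B - 1} = B - {Max B, Max B - 1}" by blast
        moreover have "\<Sum>B = Max B + \<Sum>(B - {Max B})"
          using B(1,4) by (rule sum.remove)
        ultimately show ?thesis using B(3) by simp
      qed
      ultimately have "\<Sum>(f2 B) = m - 5" using five by simp
      then have "f2 B \<in> ?P (m - 5)" using B five by (auto simp: part_sets_def f2_def)
      with max notin five show ?thesis by (simp add: f2_def)
    qed
    show "inj_on f2 A2"
    proof (rule inj_on_inverseI[of _ g2])
      fix B assume B: "B \<in> A2"
      have half: "(2 * Max B - 6) div 2 = Max B - 3" by simp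
      have "5 \<le> Max B" using f2[OF B] by blast
      then have five: "Max B - 3 + 3 = Max B" "Max B - 3 + 2 = Max B - 1" by linarith+
      have "g2 (f2 B) = {Max B, Max B - 1} \<union> (B - {Max B, Max B - 1})"
        unfolding g2_def conjunct1[OF f2[OF B]] half five
        using f2[OF B] by (simp only:)
      also have "\<dots> = B" using B fin[of B] by (auto simp: A2_def)
      finally show "g2 (f2 B) = B" .
    qed
    show "f2 ` A2 \<subseteq> ?P (m - 5)" using f2 by blast
  qed (simp add: finite_part_sets)
  moreover have "card (?P m) \<le> card A1 + card A2"
  proof -
    have "?P m = A1 \<union> A2" by (auto simp: A1_def A2_def)
    then show ?thesis using card_Un_le by metis
  qed
  ultimately show ?thesis by (simp add: distinct_gf_nth)
qed

text \<open>
A partition into distinct parts up to \<open>k\<close> either avoids \<open>k\<close> or contains it once; this recursion computes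
small coefficients.
\<close>
lemma distinct_gf_interval_rec:
  assumes "2 \<le> k"
  shows "distinct_gf {2..k} $ n = distinct_gf {2..k - 1} $ n
    + (if n < k then 0 else distinct_gf {2..k - 1} $ (n - k))"
proof -
  have "{2..k} - {k} = {2..k - 1}" using assms by auto
  then show ?thesis
    using distinct_gf_remove[of k "{2..k}"] assms
    by (simp add: distrib_right fps_X_power_mult_nth)
qed

lemma no_ones_values:
  "no_ones $ 0 = 1" "no_ones $ 1 = 0" "no_ones $ 2 = 1" "no_ones $ 3 = 1" "no_ones $ 4 = 1" "no_ones $ 5 = 2"
  "no_ones $ 6 = 2" "no_ones $ 7 = 3" "no_ones $ 8 = 3" "no_ones $ 9 = 5" "no_ones $ 10 = 5" "no_ones $ 11 = 7"
proof -
  have *: "no_ones $ n = distinct_gf {2..11} $ n" if "n \<le> 11" for n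
    using that by (intro distinct_gf_cong) auto
  show "no_ones $ 0 = 1" "no_ones $ 1 = 0" "no_ones $ 2 = 1" "no_ones $ 3 = 1" "no_ones $ 4 = 1" "no_ones $ 5 = 2"
  "no_ones $ 6 = 2" "no_ones $ 7 = 3" "no_ones $ 8 = 3" "no_ones $ 9 = 5" "no_ones $ 10 = 5" "no_ones $ 11 = 7"
    by (simp_all add: * distinct_gf_interval_rec distinct_gf_eq_prod[of "{2}"] fps_X_power_iff)
qed

text \<open>
Here \<open>Z\<close> is \<open>W/(1 - X\<^bsup>12\<^esup>)\<close>, so its coefficients are sums of coefficients of \<open>W\<close> at distance 12. Apart
from small indices, the terms of \<open>W\<close> balance in groups: \<open>2E(n-14)\<close> against \<open>2E(n-15)\<close>,
\<open>E(n-17) + 2E(n-18)\<close> against \<open>E(n-16)\<close> and \<open>E(n-20)\<close> against \<open>E(n-21)\<close>. The only negative coefficient of \<open>W\<close>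
is at 15, where \<open>E(1) = 0 < 1 = E(0)\<close> disturbs the first group. At 27 the two last terms of \<open>W\<close> make
up for it.
\<close>
lemma periodic_remainder:
  fixes Z :: "int fps"
  assumes "(1 - fps_X ^ 12) * Z
    = 2 * (fps_X ^ 14 * no_ones) - 2 * (fps_X ^ 15 * no_ones) - fps_X ^ 16 * no_ones
      + fps_X ^ 17 * no_ones + 2 * (fps_X ^ 18 * no_ones) + fps_X ^ 20 * no_ones
      - fps_X ^ 21 * no_ones + fps_X ^ 24 * no_ones + fps_X ^ 25 * no_ones" (is "_ = ?W")
  shows "Z $ 14 = 2" and "Z $ 15 = -2" and "n \<noteq> 15 \<Longrightarrow> 0 \<le> Z $ n"
proof -
  note e = no_ones_values no_ones_values(2)[simplified]
  have nonneg: "0 \<le> no_ones $ i" for i by (simp add: distinct_gf_nth)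
  have W: "?W $ n = 2 * (if n < 14 then 0 else no_ones $ (n - 14)) - 2 * (if n < 15 then 0 else no_ones $ (n - 15))
     - (if n < 16 then 0 else no_ones $ (n - 16)) + (if n < 17 then 0 else no_ones $ (n - 17))
     + 2 * (if n < 18 then 0 else no_ones $ (n - 18)) + (if n < 20 then 0 else no_ones $ (n - 20))
     - (if n < 21 then 0 else no_ones $ (n - 21)) + (if n < 24 then 0 else no_ones $ (n - 24))
     + (if n < 25 then 0 else no_ones $ (n - 25))" for n
    by (simp add: fps_X_power_mult_nth fps_double_nth)
  have rec: "Z $ n = (if n < 12 then 0 else Z $ (n - 12)) + ?W $ n" for n
    by (simp add: assms[symmetric] left_diff_distrib fps_X_power_mult_nth)
  have low: "?W $ n = 0" if "n < 14" for n unfolding W using that by simp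
  have large: "no_ones $ (n - 24) + no_ones $ (n - 25) \<le> ?W $ n" if "26 \<le> n" for n
  proof -
    obtain u where u: "n = u + 26" using \<open>26 \<le> n\<close> by (metis add.commute le_Suc_ex)
    have "no_ones $ (u + 10) \<le> no_ones $ (u + 9) + no_ones $ (u + 5)"
      using no_ones_le_add[of "u + 10"] by (simp add: add.commute)
    moreover have "no_ones $ (u + 5) \<le> no_ones $ (u + 6)" "no_ones $ (u + 6) \<le> no_ones $ (u + 7)"
       "no_ones $ (u + 7) \<le> no_ones $ (u + 8)" "no_ones $ (u + 11) \<le> no_ones $ (u + 12)"
      using no_ones_step[of "u + 5"] no_ones_step[of "u + 6"] no_ones_step[of "u + 7"] no_ones_step[of "u + 11"]
      by (simp_all add: add.commute)
    ultimately show ?thesis unfolding W u using nonneg[of "u+8"] by (simp add: add.commute)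
  qed
  have small: "?W $ n = (if n = 15 then -2 else ?W $ n) \<and> (n \<noteq> 15 \<longrightarrow> 0 \<le> ?W $ n)" if "n < 26" for n
  proof (cases "n < 14")
    case False
    with that have "n \<in> {14,15,16,17,18,19,20,21,22,23,24,25}"
      unfolding insert_iff empty_iff by arith
    then show ?thesis unfolding W by (elim insertE emptyE) (simp_all add: e)
  next
    case True
    then show ?thesis unfolding low[OF True] by simp
  qed
  show "Z $ 14 = 2"
    using rec[of 14] rec[of 2] low[of 2] unfolding W by (simp add: e)
  show Z15: "Z $ 15 = -2"
    using rec[of 15] rec[of 3] small[of 15] low[of 3] by simp
  show "n \<noteq> 15 \<Longrightarrow> 0 \<le> Z $ n"
  proof (induction n rule: less_induct)
    case (less n)
    have W: "0 \<le> ?W $ n"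
      using small[of n] large[of n] nonneg[of "n - 24"] nonneg[of "n - 25"] less.prems by linarith
    show ?case
    proof (cases "n = 27")
      case True
      then show ?thesis using rec[of 27] Z15 large[of 27] by (simp add: e)
    next
      case False
      then show ?thesis using rec[of n] W less.IH[of "n - 12"] by (cases "n < 12") auto
    qed
  qed
qed

text \<open>
The terms at \<open>5, 6, 10\<close> of the polynomial and their repetition with period 12 are split
off as \<open>H\<close> times \<open>1 - X\<^bsup>12\<^esup>\<close>. They balance by \<open>E(n-5) \<le> E(n-6) + E(n-10)\<close>, and the
rest is the periodic remainder.
\<close>
lemma reduced_difference_nonneg:
  fixes Y :: "int fps"
  assumes "(1 - fps_X ^ 12) * Y = no_ones * (2 * fps_X ^ 6 - 2 * fps_X ^ 5 + 2 * fps_X ^ 10 + 2 * fps_X ^ 14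
     - 2 * fps_X ^ 15 - fps_X ^ 16 + 3 * fps_X ^ 17 + fps_X ^ 20 - fps_X ^ 21 - 2 * fps_X ^ 22 + fps_X ^ 24 + fps_X ^ 25)"
    and "7 < n"
  shows "0 \<le> Y $ n"
proof -
  define H where "H = 2 * (fps_X ^ 6 * no_ones) - 2 * (fps_X ^ 5 * no_ones) + 2 * (fps_X ^ 10 * no_ones)"
  have "(1 - fps_X ^ 12) * (Y - H)
    = 2 * (fps_X ^ 14 * no_ones) - 2 * (fps_X ^ 15 * no_ones) - fps_X ^ 16 * no_ones
      + fps_X ^ 17 * no_ones + 2 * (fps_X ^ 18 * no_ones) + fps_X ^ 20 * no_ones
      - fps_X ^ 21 * no_ones + fps_X ^ 24 * no_ones + fps_X ^ 25 * no_ones"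
    unfolding right_diff_distrib assms(1) H_def by algebra
  note Z = periodic_remainder[OF this]
  note e = no_ones_values no_ones_values(2)[simplified]
  have H: "H $ n = 2 * (if n < 6 then 0 else no_ones $ (n - 6)) - 2 * (if n < 5 then 0 else no_ones $ (n - 5))
      + 2 * (if n < 10 then 0 else no_ones $ (n - 10))" for n
    by (simp add: H_def fps_X_power_mult_nth fps_double_nth)
  have Y: "Y $ n = H $ n + (Y - H) $ n" for n by simp
  \<comment> \<open>At 14 the part \<open>H\<close> is negative, since \<open>E(9) = 5\<close> exceeds \<open>E(8) + E(4)\<close>; at 15 the remainder is.\<close>
  consider "n = 14" | "n = 15" | "n < 14" | "16 \<le> n" by linarith
  then show ?thesis
  proof cases
    case 1
    then show ?thesis using Y[of 14] Z(1) by (simp add: H e)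
  next
    case 2
    then show ?thesis using Y[of 15] Z(2) by (simp add: H e)
  next
    case 3
    with assms(2) have "n \<in> {8,9,10,11,12,13}"
      unfolding insert_iff empty_iff by arith
    then have "0 \<le> H $ n" unfolding H by (elim insertE emptyE) (simp_all add: e)
    then show ?thesis using Y[of n] Z(3)[of n] 3 by simp
  next
    case 4
    then have "no_ones $ (n - 5) \<le> no_ones $ (n - 6) + no_ones $ (n - 10)"
      using no_ones_le_add[of "n - 5"] by simp
    then have "0 \<le> H $ n" unfolding H using 4 by simp
    then show ?thesis using Y[of n] Z(3)[of n] 4 by simp
  qed
qed

section \<open>Telescoping and truncation\<close>

lemma avoiding_insert:
  assumes "p \<notin> A" "0 < p"
  shows "avoiding A = (1 + fps_X ^ p) * avoiding (insert p A)"
proof -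
  have "{1..} - A - {p} = {1..} - insert p A" by auto
  then show ?thesis using distinct_gf_remove[of p "{1..} - A"] assms by simp
qed

lemma shifted_avoiding_nth_large:
  assumes "\<forall>k\<in>A. n < k"
  shows "(fps_X ^ i * avoiding A) $ n = (fps_X ^ i * avoiding {}) $ n"
proof -
  have "A \<inter> {1..n - i} = {}" using assms by force
  then have "avoiding A $ (n - i) = avoiding {} $ (n - i)" by (intro distinct_gf_cong) auto
  then show ?thesis by (simp add: fps_X_power_mult_nth)
qed

lemma avoiding_1: "avoiding {1} = no_ones"
proof -
  have "{1..} - {1} = {2::nat..}" by auto
  then show ?thesis by simp
qed

text \<open>
With \<open>D\<^sub>p = D/(1 + X\<^sup>p)\<close>, the difference \<open>D\<^sub>p - D\<^bsub>p-1\<^esub>\<close> is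
\<open>(X\<^bsup>p-1\<^esup> - X\<^sup>p) D/((1 + X\<^bsup>p-1\<^esup>) (1 + X\<^sup>p))\<close>. So \<open>1 - X\<close> times the summand for
\<open>p\<close> is \<open>X\<close> times this difference.
\<close>
lemma gaps2_telescope: "(1 - fps_X) * gaps2 = fps_X * (avoiding {} - avoiding {1})"
proof -
  have "(1 - fps_X) * gaps2 = fps_sum (\<lambda>j. (1 - fps_X) * (fps_X ^ (j + 2) * avoiding {j + 1, j + 2}))"
    unfolding gaps2_def by (rule fps_sum_mult) (rule fps_X_power_mult_small, simp)
  also have "\<dots> = fps_sum (\<lambda>j. fps_X * avoiding {Suc j + 1} - fps_X * avoiding {j + 1})"
  proof (rule arg_cong[where f = fps_sum], rule ext)
    fix j
    have "avoiding {j + 2} = (1 + fps_X ^ (j + 1)) * avoiding {j + 1, j + 2}"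
      using avoiding_insert[of "j + 1" "{j + 2}"] by simp
    moreover have "avoiding {j + 1} = (1 + fps_X ^ (j + 2)) * avoiding {j + 1, j + 2}"
      using avoiding_insert[of "j + 2" "{j + 1}"] by (simp add: insert_commute)
    ultimately show "(1 - fps_X) * (fps_X ^ (j + 2) * avoiding {j + 1, j + 2})
        = fps_X * avoiding {Suc j + 1} - fps_X * avoiding {j + 1}"
      by (simp add: algebra_simps)
  qed
  also have "\<dots> = fps_X * avoiding {} - fps_X * avoiding {0 + 1}"
  proof (rule fps_sum_telescope)
    show "(fps_X * avoiding {Suc n + 1}) $ n = (fps_X * avoiding {}) $ n" for n
      using shifted_avoiding_nth_large[of "{Suc n + 1}" n 1] by simp
  qed
  finally show ?thesis by (simp add: algebra_simps)
qed

text \<open>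
The same idea with two adjacent factors: from \<open>p - 2, p - 1\<close> to \<open>p - 1, p\<close> the product of the two
reciprocals changes by \<open>X\<^bsup>p-2\<^esup> - X\<^sup>p\<close> times the product of all three.
\<close>
lemma gaps3_telescope: "(1 - fps_X ^ 2) * gaps3 = fps_X ^ 2 * (avoiding {} - avoiding {1, 2})"
proof -
  have "(1 - fps_X ^ 2) * gaps3
      = fps_sum (\<lambda>j. (1 - fps_X ^ 2) * (fps_X ^ (j + 3) * avoiding {j + 1, j + 2, j + 3}))"
    unfolding gaps3_def by (rule fps_sum_mult) (rule fps_X_power_mult_small, simp)
  also have "\<dots> = fps_sum (\<lambda>j. fps_X ^ 2 * avoiding {Suc j + 1, Suc j + 2} - fps_X ^ 2 * avoiding {j + 1, j + 2})"
  proof (rule arg_cong[where f = fps_sum], rule ext)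
    fix j
    have "avoiding {j + 2, j + 3} = (1 + fps_X ^ (j + 1)) * avoiding {j + 1, j + 2, j + 3}"
      using avoiding_insert[of "j + 1" "{j + 2, j + 3}"] by simp
    moreover have "avoiding {j + 1, j + 2} = (1 + fps_X ^ (j + 3)) * avoiding {j + 1, j + 2, j + 3}"
      using avoiding_insert[of "j + 3" "{j + 1, j + 2}"] by (simp add: insert_commute)
    ultimately show "(1 - fps_X ^ 2) * (fps_X ^ (j + 3) * avoiding {j + 1, j + 2, j + 3})
        = fps_X ^ 2 * avoiding {Suc j + 1, Suc j + 2} - fps_X ^ 2 * avoiding {j + 1, j + 2}"
      by (simp add: algebra_simps power2_eq_square eval_nat_numeral)
  qed
  also have "\<dots> = fps_X ^ 2 * avoiding {} - fps_X ^ 2 * avoiding {0 + 1, 0 + 2}"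
  proof (rule fps_sum_telescope)
    show "(fps_X ^ 2 * avoiding {Suc n + 1, Suc n + 2}) $ n = (fps_X ^ 2 * avoiding {}) $ n" for n
      by (rule shifted_avoiding_nth_large) simp
  qed
  finally show ?thesis by (simp only: right_diff_distrib add_0)
qed

text \<open>
Adding \<open>p\<close> to the largest part never creates the part \<open>p\<close>. The empty partition has no
largest part; it is sent to the partition of \<open>p\<close> into \<open>1\<close> and \<open>p - 1\<close>, which are distinct for \<open>p \<ge> 3\<close>.
\<close>
lemma avoiding_shift_le:
  assumes "3 \<le> p"
  shows "avoiding {p} $ m \<le> avoiding {p} $ (m + p)"
proof (cases "m = 0")
  case True
  have "B = {}" if "B \<in> part_sets ({1..} - {p}) 0" for B
  proof -
    have "x \<notin> B" for x
    proof
      assume "x \<in> B"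
      then have "x \<le> 0" "1 \<le> x" using mem_part_sets_le[OF that] that
        by (blast, auto simp: part_sets_def)
      then show False by simp
    qed
    then show ?thesis by blast
  qed
  moreover have "{} \<in> part_sets ({1..} - {p}) 0" by (simp add: part_sets_def)
  ultimately have "part_sets ({1..} - {p}) 0 = {{}}" by blast
  moreover have "{1, p - 1} \<in> part_sets ({1..} - {p}) p"
    using assms by (auto simp: part_sets_def)
  then have "0 < card (part_sets ({1..} - {p}) p)"
    using finite_part_sets card_gt_0_iff by blast
  ultimately show ?thesis using True by (simp add: distinct_gf_nth)
next
  case False
  then show ?thesis by (intro distinct_gf_shift_le) auto
qed

text \<open>
This is \<open>2x/(1 + x) \<le> 2x - 2x\<^sup>2 + 2x\<^sup>3 - x\<^sup>4\<close>, read coefficientwise after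
multiplication by \<open>D\<close>. The difference of the two sides is \<open>x\<^sup>4 - x\<^sup>5\<close> times \<open>D/(1 + x)\<close>, which is the series
of the partitions without the part \<open>p\<close>. Halving the last term keeps the error
small: at \<open>x = 1\<close> it vanishes.
\<close>
lemma avoiding_truncation:
  assumes "3 \<le> p"
  shows "2 * (fps_X ^ p * avoiding {p}) $ n
    \<le> (2 * (fps_X ^ p * avoiding {}) - 2 * (fps_X ^ (2 * p) * avoiding {}) + 2 * (fps_X ^ (3 * p) * avoiding {})
        - fps_X ^ (4 * p) * avoiding {}) $ n"
proof -
  define x where "x = (fps_X ^ p :: int fps)"
  have D: "avoiding {} = (1 + x) * avoiding {p}"
    using avoiding_insert[of p "{}"] assms by (simp add: x_def)
  have pow: "fps_X ^ (k * p) = x ^ k" for k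
    by (simp add: x_def mult.commute flip: power_mult)
  have "2 * (x * avoiding {}) - 2 * (x ^ 2 * avoiding {}) + 2 * (x ^ 3 * avoiding {}) - x ^ 4 * avoiding {}
      - 2 * (x * avoiding {p}) = x ^ 4 * avoiding {p} - x ^ 5 * avoiding {p}"
    unfolding D by algebra
  then have "(2 * (fps_X ^ p * avoiding {}) - 2 * (fps_X ^ (2 * p) * avoiding {}) + 2 * (fps_X ^ (3 * p) * avoiding {})
        - fps_X ^ (4 * p) * avoiding {}) $ n - (2 * (fps_X ^ p * avoiding {p})) $ n
      = (fps_X ^ (4 * p) * avoiding {p}) $ n - (fps_X ^ (5 * p) * avoiding {p}) $ n"
    unfolding pow x_def[symmetric] by (simp only: fps_sub_nth[symmetric])
  moreover have "(fps_X ^ (5 * p) * avoiding {p}) $ n \<le> (fps_X ^ (4 * p) * avoiding {p}) $ n"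
  proof (cases "n < 5 * p")
    case True
    then show ?thesis by (simp add: fps_X_power_mult_nth distinct_gf_nth)
  next
    case False
    then have "n - 4 * p = n - 5 * p + p" by simp
    then show ?thesis using False avoiding_shift_le[OF assms, of "n - 5 * p"]
      by (simp add: fps_X_power_mult_nth)
  qed
  ultimately show ?thesis by (simp add: fps_double_nth)
qed

text \<open>
Twice the exact summands for \<open>p = 2, 3\<close>, and the truncations of the others, summed over
\<open>p = j + 4\<close>.
\<close>
definition parts_ge_2_bound :: "int fps" where
  "parts_ge_2_bound = 2 * (fps_X ^ 2 * avoiding {2}) + 2 * (fps_X ^ 3 * avoiding {3})
    + (2 * progression 4 1 (avoiding {}) - 2 * progression 8 2 (avoiding {}) + 2 * progression 12 3 (avoiding {})
       - progression 16 4 (avoiding {}))"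

lemma parts_ge_2_le: "2 * parts_ge_2 $ n \<le> parts_ge_2_bound $ n"
proof -
  let ?D = "avoiding {}"
  have shift: "0 + 2 = (2 :: nat)" "Suc j + 2 = j + 3" "0 + 3 = (3 :: nat)" "Suc j + 3 = j + 4" for j
    by simp_all
  have "parts_ge_2 = fps_X ^ (0 + 2) * avoiding {0 + 2} + fps_sum (\<lambda>j. fps_X ^ (Suc j + 2) * avoiding {Suc j + 2})"
    unfolding parts_ge_2_def by (rule fps_sum_shift) (rule fps_X_power_mult_small, simp)
  moreover have "fps_sum (\<lambda>j. fps_X ^ (j + 3) * avoiding {j + 3})
      = fps_X ^ (0 + 3) * avoiding {0 + 3} + fps_sum (\<lambda>j. fps_X ^ (Suc j + 3) * avoiding {Suc j + 3})"
    by (rule fps_sum_shift) (rule fps_X_power_mult_small, simp)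
  ultimately have parts: "parts_ge_2 = fps_X ^ 2 * avoiding {2} + (fps_X ^ 3 * avoiding {3}
      + fps_sum (\<lambda>j. fps_X ^ (j + 4) * avoiding {j + 4}))"
    by (simp only: shift)
  have "2 * fps_sum (\<lambda>j. fps_X ^ (j + 4) * avoiding {j + 4}) $ n
      \<le> (\<Sum>j\<le>n. (2 * (fps_X ^ (j + 4) * ?D) - 2 * (fps_X ^ (2 * (j + 4)) * ?D)
          + 2 * (fps_X ^ (3 * (j + 4)) * ?D) - fps_X ^ (4 * (j + 4)) * ?D) $ n)"
    unfolding fps_sum_nth sum_distrib_left by (intro sum_mono avoiding_truncation) simp
  also have "\<dots> = (2 * progression 4 1 ?D - 2 * progression 8 2 ?D + 2 * progression 12 3 ?D
       - progression 16 4 ?D) $ n"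
    by (simp add: progression_def fps_sum_nth fps_double_nth sum.distrib sum_subtractf sum_distrib_left algebra_simps)
  finally show ?thesis
    unfolding parts parts_ge_2_bound_def by (simp add: fps_double_nth)
qed

section \<open>The two inequalities\<close>

text \<open>
Since \<open>gaps2\<close> equals \<open>X\<^sup>2 D/(1 - X\<^sup>2)\<close>, multiplying the difference by \<open>1 - X\<^sup>4\<close> leaves
\<open>(X\<^sup>3 - X\<^sup>4 + X\<^sup>5) D\<close>, whose coefficients are nonnegative as those of \<open>D\<close> increase.
\<close>
lemma hooks_2_le: "hooks_distinct 2 n \<le> hooks_odd 2 n"
proof -
  define D where "D = avoiding {}"
  define Y where "Y = progression 2 4 D + progression 3 2 D - gaps2"
  have D: "odd_gf = D" using distinct_gf_eq_partition_gf_odd by (simp add: D_def)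
  have E: "D = (1 + fps_X) * avoiding {1}" using avoiding_insert[of 1 "{}"] by (simp add: D_def)
  have "(1 - fps_X ^ 4) * Y = (fps_X ^ 3 - fps_X ^ 4 + fps_X ^ 5) * D"
  proof -
    have "(1 - fps_X ^ 4) * Y = (1 - fps_X ^ 4) * progression 2 4 D
        + (1 + fps_X ^ 2) * ((1 - fps_X ^ 2) * progression 3 2 D)
        - (1 + fps_X ^ 2) * (1 + fps_X) * ((1 - fps_X) * gaps2)"
      unfolding Y_def by algebra
    also have "\<dots> = fps_X ^ 2 * D + (1 + fps_X ^ 2) * (fps_X ^ 3 * D)
        - (1 + fps_X ^ 2) * (1 + fps_X) * (fps_X * (D - avoiding {1}))"
      by (simp only: progression_mult gaps2_telescope zero_less_numeral D_def[symmetric])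
    also have "\<dots> = (fps_X ^ 3 - fps_X ^ 4 + fps_X ^ 5) * D"
      unfolding E by algebra
    finally show ?thesis .
  qed
  then have rec: "Y $ n - (fps_X ^ 4 * Y) $ n
      = (fps_X ^ 3 * D) $ n - (fps_X ^ 4 * D) $ n + (fps_X ^ 5 * D) $ n" for n
    by (simp only: left_diff_distrib distrib_right mult_1_left flip: fps_sub_nth fps_add_nth)
  have mono: "D $ m \<le> D $ Suc m" for m
  proof (cases "m = 0")
    case True
    have "D $ 0 = 1" "D $ 1 = 1"
      unfolding E avoiding_1 by (simp_all add: no_ones_values no_ones_values(2)[simplified] distrib_right)
    with True show ?thesis by simp
  next
    case False
    then show ?thesis unfolding D_def using distinct_gf_shift_le[of "{1..} - {}" 1 m] by simp
  qed
  have "0 \<le> Y $ n" for n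
  proof (induction n rule: less_induct)
    case (less n)
    have "0 \<le> (fps_X ^ 4 * Y) $ n" using less by (simp add: fps_X_power_mult_nth)
    moreover have "(fps_X ^ 4 * D) $ n \<le> (fps_X ^ 3 * D) $ n"
    proof (cases "n < 4")
      case True
      then show ?thesis by (simp add: fps_X_power_mult_nth D_def distinct_gf_nth)
    next
      case False
      then have "Suc (n - 4) = n - 3" by simp
      then show ?thesis using False mono[of "n - 4"] by (simp add: fps_X_power_mult_nth)
    qed
    moreover have "0 \<le> (fps_X ^ 5 * D) $ n" by (simp add: fps_X_power_mult_nth D_def distinct_gf_nth)
    ultimately show ?case using rec[of n] by linarith
  qed
  then have "0 \<le> Y $ n" .
  then show ?thesis
    using hooks_distinct_2[of n] hooks_odd_2[of n] by (simp add: Y_def D)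
qed

text \<open>
The lower bound \<open>Y\<close> for twice the difference has the denominators \<open>1 - X\<^sup>k\<close> with \<open>k\<close> in \<open>{1, 2, 3, 4, 6}\<close>, and
\<open>1 + X\<^sup>2\<close> and \<open>1 + X\<^sup>3\<close>; all of them divide \<open>1 - X\<^bsup>12\<^esup>\<close>. Multiplying by this polynomial reduces the claim
to an identity of polynomials times \<open>E\<close>.
\<close>
lemma hooks_3_le:
  assumes "7 < n"
  shows "hooks_distinct 3 n \<le> hooks_odd 3 n"
proof -
  define D where "D = avoiding {}"
  define N where "N = avoiding {1, 2}"
  define x where "x = (fps_X :: int fps)"
  define Y where "Y = 2 * (progression 3 6 D + progression 6 4 D + (progression 3 2 D - progression 4 4 D))
     - 2 * gaps3 + 2 * gaps2 - parts_ge_2_bound"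
  have D: "odd_gf = D" using distinct_gf_eq_partition_gf_odd by (simp add: D_def)
  note E = avoiding_1
  have DE: "D = (1 + x) * no_ones"
    using avoiding_insert[of 1 "{}"] by (simp add: D_def x_def flip: E)
  have EN: "no_ones = (1 + x ^ 2) * N"
    using avoiding_insert[of 2 "{1}"] by (simp add: N_def x_def insert_commute flip: E)
  have F2: "(1 + x ^ 2) * avoiding {2} = D" and F3: "(1 + x ^ 3) * avoiding {3} = D"
    using avoiding_insert[of 2 "{}"] avoiding_insert[of 3 "{}"] by (simp_all add: D_def x_def)
  have "0 \<le> Y $ n"
  proof (rule reduced_difference_nonneg)
    note p = progression_mult[of _ _ D, folded x_def]
    note g2 = gaps2_telescope[folded x_def D_def, unfolded E]
    note g3 = gaps3_telescope[folded x_def D_def N_def]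
    \<comment> \<open>The cofactor of each denominator in \<open>1 - x ^ 12\<close> is written out in front of it.\<close>
    have "(1 - x ^ 12) * Y = 2 * ((1 + x ^ 6) * ((1 - x ^ 6) * progression 3 6 D)
         + (1 + x ^ 4 + x ^ 8) * ((1 - x ^ 4) * progression 6 4 D)
         + ((1 + x ^ 2) * (1 + x ^ 4 + x ^ 8) * ((1 - x ^ 2) * progression 3 2 D)
           - (1 + x ^ 4 + x ^ 8) * ((1 - x ^ 4) * progression 4 4 D)))
       - 2 * ((1 + x ^ 2) * (1 + x ^ 4 + x ^ 8) * ((1 - x ^ 2) * gaps3))
       + 2 * ((1 + x) * (1 + x ^ 2) * (1 + x ^ 4 + x ^ 8) * ((1 - x) * gaps2))
       - (2 * (x ^ 2 * (1 - x ^ 2) * (1 + x ^ 4 + x ^ 8) * ((1 + x ^ 2) * avoiding {2}))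
         + 2 * (x ^ 3 * (1 - x ^ 3) * (1 + x ^ 6) * ((1 + x ^ 3) * avoiding {3}))
         + (2 * ((1 + x) * (1 + x ^ 2) * (1 + x ^ 4 + x ^ 8) * ((1 - x ^ 1) * progression 4 1 D))
           - 2 * ((1 + x ^ 2) * (1 + x ^ 4 + x ^ 8) * ((1 - x ^ 2) * progression 8 2 D))
           + 2 * ((1 + x ^ 3) * (1 + x ^ 6) * ((1 - x ^ 3) * progression 12 3 D))
           - (1 + x ^ 4 + x ^ 8) * ((1 - x ^ 4) * progression 16 4 D)))"
      unfolding Y_def parts_ge_2_bound_def D_def[symmetric] x_def[symmetric] by algebra
    also have "\<dots> = 2 * ((1 + x ^ 6) * (x ^ 3 * D) + (1 + x ^ 4 + x ^ 8) * (x ^ 6 * D)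
         + ((1 + x ^ 2) * (1 + x ^ 4 + x ^ 8) * (x ^ 3 * D) - (1 + x ^ 4 + x ^ 8) * (x ^ 4 * D)))
       - 2 * ((1 + x ^ 2) * (1 + x ^ 4 + x ^ 8) * (x ^ 2 * (D - N)))
       + 2 * ((1 + x) * (1 + x ^ 2) * (1 + x ^ 4 + x ^ 8) * (x * (D - no_ones)))
       - (2 * (x ^ 2 * (1 - x ^ 2) * (1 + x ^ 4 + x ^ 8) * D)
         + 2 * (x ^ 3 * (1 - x ^ 3) * (1 + x ^ 6) * D)
         + (2 * ((1 + x) * (1 + x ^ 2) * (1 + x ^ 4 + x ^ 8) * (x ^ 4 * D))
           - 2 * ((1 + x ^ 2) * (1 + x ^ 4 + x ^ 8) * (x ^ 8 * D))
           + 2 * ((1 + x ^ 3) * (1 + x ^ 6) * (x ^ 12 * D))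
           - (1 + x ^ 4 + x ^ 8) * (x ^ 16 * D)))"
      by (simp only: p g2 g3 F2 F3 zero_less_numeral zero_less_one)
    also have "\<dots> = no_ones * (2 * x ^ 6 - 2 * x ^ 5 + 2 * x ^ 10 + 2 * x ^ 14
     - 2 * x ^ 15 - x ^ 16 + 3 * x ^ 17 + x ^ 20 - x ^ 21 - 2 * x ^ 22 + x ^ 24 + x ^ 25)"
      unfolding DE EN by algebra
    finally show "(1 - fps_X ^ 12) * Y = no_ones * (2 * fps_X ^ 6 - 2 * fps_X ^ 5 + 2 * fps_X ^ 10 + 2 * fps_X ^ 14
     - 2 * fps_X ^ 15 - fps_X ^ 16 + 3 * fps_X ^ 17 + fps_X ^ 20 - fps_X ^ 21 - 2 * fps_X ^ 22 + fps_X ^ 24 + fps_X ^ 25)"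
      unfolding x_def .
  qed (rule assms)
  then show ?thesis
    using hooks_distinct_3[of n] hooks_odd_3[of n] parts_ge_2_le[of n]
    by (simp add: Y_def D fps_double_nth)
qed

theorem theorem1p8:
  shows "(\<forall>n::nat. hooks_odd 2 n \<ge> hooks_distinct 2 n) \<and> (\<forall>n::nat. n > 7 \<longrightarrow> hooks_odd 3 n \<ge> hooks_distinct 3 n)"
  using hooks_2_le hooks_3_le by blast

end
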